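(* Let $n\ge 1$, $1<p<\infty$, $z_0=(z_0^{(1)},\ldots,z_0^{(n)})\in B_n$ and $w_0\in\mathbb{C}$. Among all $f\in H^p(B_n)$ satisfying the single interpolation condition $f(z_0)=w_0$ there is a unique one of minimal $H^p(B_n)$-norm, and it is given by $$f_{\min}(z)=w_0\left(\frac{1-\|z_0\|_{\rm Eucl}^2}{1-\langle z,z_0\rangle_{\rm Eucl}}\right)^{\frac{2n}{p}}=w_0\left(\frac{1-\sum_{j=1}^n|z_0^{(j)}|^2}{1-\sum_{j=1}^n z_j\overline{z_0^{(j)}}}\right)^{\frac{2n}{p}},\qquad z=(z_1,\ldots,z_n)\in B_n.$$ In addition, $\|f_{\min}\|_{H^p(B_n)}=|w_0|\,(1-\|z_0\|_{\rm Eucl}^2)^{\frac np}$.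
   Context: $\langle z,w\rangle_{\rm Eucl}=\sum_{i=1}^n z_i\overline{w_i}$ is the Euclidean inner product on $\mathbb{C}^n$, with norm $\|\cdot\|_{\rm Eucl}$; $B_n=\{z\in\mathbb{C}^n:\|z\|_{\rm Eucl}<1\}$ is the open unit ball and $S_n=\{z\in\mathbb{C}^n:\|z\|_{\rm Eucl}=1\}$ the unit sphere, with rotation-invariant Borel probability measure $\sigma$. The Hardy space $H^p(B_n)$ is the space of holomorphic functions $f:B_n\to\mathbb{C}$ with $$\|f\|_{H^p(B_n)}=\sup_{0<r<1}\left(\int_{S_n}|f(rz)|^p\,d\sigma(z)\right)^{1/p}<\infty .$$ The fractional power is taken with the principal branch (the base has positive real part on $B_n$). *)

theory Defs
  imports "HOL-Probability.Probability"
begin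

definition herm_inner :: "complex ^ 'n \<Rightarrow> complex ^ 'n \<Rightarrow> complex" where
  "herm_inner z w = (\<Sum>i\<in>UNIV. z $ i * cnj (w $ i))"

text \<open>The library norm on \<^typ>\<open>complex ^ 'n\<close> is the Euclidean norm, so the unit ball and the unit
  sphere are \<^term>\<open>ball 0 1\<close> and \<^term>\<open>sphere 0 1\<close>.\<close>

lemma herm_inner_self:
  fixes z :: "complex ^ 'n"
  shows "herm_inner z z = complex_of_real ((norm z)\<^sup>2)"
  unfolding herm_inner_def norm_vec_def L2_set_def
  by (simp add: complex_norm_square[symmetric] sum_nonneg)

text \<open>Rotations are the real orthogonal maps of \<open>\<complex>\<^sup>n = \<real>\<^sup>2\<^sup>n\<close>; the underlying space of
  \<open>\<sigma>\<close> is the sphere itself.\<close>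

definition rotation_invariant_prob :: "(complex ^ 'n) measure \<Rightarrow> bool" where
  "rotation_invariant_prob \<sigma> \<longleftrightarrow>
     prob_space \<sigma> \<and>
     sets \<sigma> = sets (restrict_space borel (sphere 0 1)) \<and>
     (\<forall>T. orthogonal_transformation T \<longrightarrow>
        (\<forall>A\<in>sets \<sigma>. emeasure \<sigma> (T ` A) = emeasure \<sigma> A))"

definition holomorphic_vec_on :: "(complex ^ 'n \<Rightarrow> complex) \<Rightarrow> (complex ^ 'n) set \<Rightarrow> bool"
    (infixl "holomorphic'_vec'_on" 50) where
  "f holomorphic_vec_on U \<longleftrightarrow>
     (\<forall>z\<in>U. \<exists>D. (f has_derivative D) (at z) \<and> (\<forall>c v. D (c *s v) = c * D v))"

text \<open>For \<open>f\<close> holomorphic on the unit ball the integrands are continuous on the compact sphere, so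
  the Bochner integrals are genuine. The supremum is taken in \<^typ>\<open>ennreal\<close>, with value
  \<open>\<infinity>\<close> if the integral means are unbounded.\<close>

definition hardy_norm ::
    "(complex ^ 'n) measure \<Rightarrow> real \<Rightarrow> (complex ^ 'n \<Rightarrow> complex) \<Rightarrow> ennreal" where
  "hardy_norm \<sigma> p f =
     (SUP r\<in>{0<..<1}. ennreal ((\<integral>\<zeta>. norm (f (r *\<^sub>R \<zeta>)) powr p \<partial>\<sigma>) powr (1 / p)))"

text \<open>Elements are total functions; only their values on the unit ball matter.\<close>

definition hardy_space ::
    "(complex ^ 'n) measure \<Rightarrow> real \<Rightarrow> (complex ^ 'n \<Rightarrow> complex) set" where
  "hardy_space \<sigma> p = {f. f holomorphic_vec_on ball 0 1 \<and> hardy_norm \<sigma> p f < \<infinity>}"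

definition minimal_interpolant ::
    "(complex ^ 'n) measure \<Rightarrow> real \<Rightarrow> complex ^ 'n \<Rightarrow> complex \<Rightarrow> (complex ^ 'n \<Rightarrow> complex) \<Rightarrow> bool"
  where
  "minimal_interpolant \<sigma> p z0 w0 f \<longleftrightarrow>
     f \<in> hardy_space \<sigma> p \<and> f z0 = w0 \<and>
     (\<forall>g\<in>hardy_space \<sigma> p. g z0 = w0 \<longrightarrow> hardy_norm \<sigma> p f \<le> hardy_norm \<sigma> p g)"

text \<open>Existence of \<open>\<sigma>\<close>: push Lebesgue measure on the punctured unit ball forward along the
  radial projection.\<close>

lemma nn_integral_lborel_shift:
  fixes c :: "'a :: euclidean_space"
  assumes [measurable]: "f \<in> borel_measurable borel"
  shows "(\<integral>\<^sup>+x. f (c + x) \<partial>lborel) = (\<integral>\<^sup>+x. f x \<partial>lborel)"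
proof -
  have "(\<integral>\<^sup>+x. f x \<partial>lborel) = (\<integral>\<^sup>+x. f x \<partial>distr lborel borel ((+) c))"
    by (simp add: lborel_distr_plus)
  also have "\<dots> = (\<integral>\<^sup>+x. f (c + x) \<partial>lborel)"
    by (subst nn_integral_distr) auto
  finally show ?thesis by simp
qed

lemma lborel_orthogonal_vimage:
  fixes T :: "'a :: euclidean_space \<Rightarrow> 'a"
  assumes T: "orthogonal_transformation T" and A [measurable]: "A \<in> sets borel"
  shows "emeasure lborel (T -` A) = emeasure lborel A"
proof -
  define b where "b = emeasure lborel (ball (0 :: 'a) 1)"
  define T' where "T' = inv T"
  have [measurable]: "ball (0 :: 'a) 1 \<in> sets borel" by simp
  have bT: "bij T" using T by (rule orthogonal_transformation_bij)
  have TT': "T (T' y) = y" for y unfolding T'_def by (simp add: bT bij_is_surj surj_f_inv_f)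
  have linT: "linear T" using T by (simp add: orthogonal_transformation_def)
  have Tm [measurable]: "T \<in> borel_measurable borel"
    by (intro borel_measurable_continuous_onI linear_continuous_on
          linear_conv_bounded_linear[THEN iffD1] linT)
  have TA [measurable]: "T -` A \<in> sets borel" using measurable_sets[OF Tm A] by simp
  have shiftT: "(\<integral>\<^sup>+x. indicator A (y + T x) \<partial>lborel) = emeasure lborel (T -` A)" for y
  proof -
    have "(\<integral>\<^sup>+x. indicator A (y + T x) \<partial>lborel) = (\<integral>\<^sup>+x. indicator (T -` A) (T' y + x) \<partial>lborel)"
      by (intro nn_integral_cong) (simp add: indicator_def linear_add[OF linT] TT')
    also have "\<dots> = emeasure lborel (T -` A)"
      by (subst nn_integral_lborel_shift) auto
    finally show ?thesis .
  qed
  have ballT: "(\<integral>\<^sup>+x. indicator (ball 0 1) (- T x + y) \<partial>lborel) = b" for y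
  proof -
    have "norm (- T x + y) = norm (- T' y + x)" for x
    proof -
      have "- T x + y = T (T' y - x)" by (simp add: linear_diff[OF linT] TT')
      then show ?thesis
        using orthogonal_transformation_norm[OF T] by (metis norm_minus_commute uminus_add_conv_diff)
    qed
    then have "(\<integral>\<^sup>+x. indicator (ball 0 1) (- T x + y) \<partial>lborel) =
        (\<integral>\<^sup>+x. indicator (ball 0 1) (- T' y + x) \<partial>lborel)"
      by (intro nn_integral_cong) (simp add: indicator_def)
    also have "\<dots> = b"
      unfolding b_def
      by (subst nn_integral_lborel_shift) (auto intro!: borel_measurable_indicator)
    finally show ?thesis .
  qed
  have "emeasure lborel (T -` A) * b =
      (\<integral>\<^sup>+y. indicator (ball 0 1) y * (\<integral>\<^sup>+x. indicator A (y + T x) \<partial>lborel) \<partial>lborel)"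
    unfolding shiftT b_def
    by (subst nn_integral_multc) (auto simp: mult.commute intro!: borel_measurable_indicator)
  also have "\<dots> = (\<integral>\<^sup>+y. \<integral>\<^sup>+x. indicator (ball 0 1) y * indicator A (y + T x) \<partial>lborel \<partial>lborel)"
    by (intro nn_integral_cong nn_integral_cmult[symmetric]) measurable
  also have "\<dots> = (\<integral>\<^sup>+x. \<integral>\<^sup>+y. indicator (ball 0 1) y * indicator A (y + T x) \<partial>lborel \<partial>lborel)"
    by (rule lborel_pair.Fubini') measurable
  also have "\<dots> = (\<integral>\<^sup>+x. \<integral>\<^sup>+y. indicator (ball 0 1) (- T x + y) * indicator A y \<partial>lborel \<partial>lborel)"
  proof (rule nn_integral_cong)
    fix x :: 'a
    have "(\<integral>\<^sup>+y. indicator (ball 0 1) (- T x + y) * indicator A ((- T x + y) + T x) \<partial>lborel) =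
        (\<integral>\<^sup>+y. indicator (ball 0 1) y * (indicator A (y + T x) :: ennreal) \<partial>lborel)"
      by (rule nn_integral_lborel_shift) measurable
    then show "(\<integral>\<^sup>+y. indicator (ball 0 1) y * (indicator A (y + T x) :: ennreal) \<partial>lborel) =
        (\<integral>\<^sup>+y. indicator (ball 0 1) (- T x + y) * indicator A y \<partial>lborel)"
      by simp
  qed
  also have "\<dots> = (\<integral>\<^sup>+y. \<integral>\<^sup>+x. indicator (ball 0 1) (- T x + y) * indicator A y \<partial>lborel \<partial>lborel)"
    by (rule lborel_pair.Fubini') measurable
  also have "\<dots> = (\<integral>\<^sup>+y. b * indicator A y \<partial>lborel)"
    by (subst nn_integral_multc, measurable) (simp only: ballT)
  also have "\<dots> = emeasure lborel A * b"
    by (simp add: nn_integral_cmult mult.commute)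
  finally have eq: "emeasure lborel (T -` A) * b = emeasure lborel A * b" .
  have "b \<noteq> 0"
    unfolding b_def using content_ball_pos[of 1 "0 :: 'a"] by (auto simp: measure_def)
  moreover have "b \<noteq> top"
    unfolding b_def using emeasure_lborel_ball_finite[of "0 :: 'a" 1] by auto
  ultimately show ?thesis
    using eq by (metis ennreal_mult_cancel_left mult.commute)
qed

lemma rotation_invariant_prob_exists:
  "\<exists>\<sigma> :: (complex ^ 'n) measure. rotation_invariant_prob \<sigma>"
proof -
  define B where "B = ball (0 :: complex ^ 'n) 1 - {0}"
  define e :: "complex ^ 'n" where "e = axis undefined 1"
  define g where "g x = (if x = 0 then e else sgn x)" for x :: "complex ^ 'n"
  define S where "S = restrict_space borel (sphere (0 :: complex ^ 'n) 1)"
  define \<sigma> where "\<sigma> = distr (uniform_measure lborel B) S g"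
  have B [measurable]: "B \<in> sets borel" by (simp add: B_def)
  have Bm: "emeasure lborel B = emeasure lborel (ball (0 :: complex ^ 'n) 1)"
    unfolding B_def by (rule emeasure_Diff_null_set) auto
  have B0: "emeasure lborel B \<noteq> 0"
    unfolding Bm
    using content_ball_pos[of 1 "0 :: complex ^ 'n"] by (auto simp: measure_def)
  have Bf: "emeasure lborel B \<noteq> \<infinity>"
    unfolding Bm using emeasure_lborel_ball_finite by (simp add: less_top)
  interpret U: prob_space "uniform_measure lborel B"
    by (rule prob_space_uniform_measure[OF B0 Bf])
  have gs: "g x \<in> sphere 0 1" for x
    by (auto simp: g_def e_def norm_sgn)
  have gb: "g \<in> borel_measurable borel"
    unfolding g_def by measurable
  have gm: "g \<in> uniform_measure lborel B \<rightarrow>\<^sub>M S"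
    unfolding S_def using gb gs by (intro measurable_restrict_space2) auto
  have "prob_space \<sigma>"
    unfolding \<sigma>_def by (rule U.prob_space_distr[OF gm])
  moreover have "sets \<sigma> = sets S" by (simp add: \<sigma>_def)
  moreover have "emeasure \<sigma> (T ` A) = emeasure \<sigma> A"
    if T: "orthogonal_transformation T" and A: "A \<in> sets \<sigma>"
    for T :: "complex ^ 'n \<Rightarrow> complex ^ 'n" and A
  proof -
    define R where "R = inv T"
    have bT: "bij T" using T by (rule orthogonal_transformation_bij)
    have R: "orthogonal_transformation R"
      unfolding R_def using T by (rule orthogonal_transformation_inv)
    have nR: "norm (R x) = norm x" for x
      using R by (rule orthogonal_transformation_norm)
    have linR: "linear R" using R by (simp add: orthogonal_transformation_def)
    have R0: "R x = 0 \<longleftrightarrow> x = 0" for x using nR[of x] by (metis norm_eq_zero)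
    have gR: "g (R x) = R (g x)" if "x \<noteq> 0" for x
      using that R0[of x] by (simp add: g_def sgn_div_norm nR linear_scale[OF linR])
    have TA_eq: "T ` A = R -` A"
      unfolding R_def using bT by (metis bij_imp_bij_inv bij_vimage_eq_inv_image inv_inv_eq)
    have Rm: "R \<in> borel_measurable borel"
      by (intro borel_measurable_continuous_onI linear_continuous_on
            linear_conv_bounded_linear[THEN iffD1] linR)
    have AS: "A \<in> sets S" using A by (simp add: \<sigma>_def)
    have A': "A \<in> sets borel" "A \<subseteq> sphere 0 1"
      using AS by (auto simp: S_def sets_restrict_space_iff)
    have "R -` A \<in> sets borel" using measurable_sets[OF Rm A'(1)] by simp
    then have TA: "R -` A \<in> sets S"
      using A' nR by (auto simp: S_def sets_restrict_space_iff subset_iff)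
    have em: "emeasure \<sigma> C = emeasure lborel (B \<inter> g -` C) / emeasure lborel B"
      and pre: "B \<inter> g -` C \<in> sets borel" if "C \<in> sets S" for C
    proof -
      have C: "C \<in> sets borel" using that by (auto simp: S_def sets_restrict_space)
      have m: "g -` C \<in> sets borel" using measurable_sets[OF gb C] by simp
      then show "emeasure \<sigma> C = emeasure lborel (B \<inter> g -` C) / emeasure lborel B"
        unfolding \<sigma>_def using that gm by (subst emeasure_distr) auto
      show "B \<inter> g -` C \<in> sets borel" using m by simp
    qed
    have "B \<inter> g -` (R -` A) = R -` (B \<inter> g -` A)"
      using gR nR R0 by (auto simp: B_def)
    then show ?thesis
      by (simp only: TA_eq em[OF TA] em[OF AS] lborel_orthogonal_vimage[OF R pre[OF AS]])
  qed
  ultimately show ?thesis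
    unfolding rotation_invariant_prob_def S_def by blast
qed

end

theory Submission
  imports Defs "HOL-Complex_Analysis.Cauchy_Integral_Formula"
begin

text \<open>Rotation invariance gives the moments of \<open>\<langle>x,u\<rangle>\<close> on the sphere, hence the Cauchy formula with
  kernel \<open>(1 - \<langle>w,x\<rangle>)\<^bsup>-n\<^esup>\<close> and, after multiplying \<open>f\<close> by \<open>(1 - \<langle>x,a\<rangle>)\<^bsup>-n\<^esup>\<close>, the Poisson formula for
  functions holomorphic near the closed ball. On the sphere the extremal function \<open>H\<close> for the value
  \<open>1\<close> at \<open>a\<close> satisfies \<open>cmod H\<^sup>p = (1 - norm a\<^sup>2)\<^sup>n P\<close> with \<open>P\<close> the Poisson kernel of \<open>a\<close>, so the
  \<open>p\<close>-th mean of \<open>g(rx)\<close> is, up to this constant, the \<open>P\<close>-mean of \<open>cmod (g(rx) / H(x))\<^sup>p\<close>. Jensen's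
  inequality for the strictly convex function \<open>cmod w\<^sup>p\<close>, applied at each radius \<open>r < 1\<close>, gives the
  bound, and the defect in it gives uniqueness; boundary values are never needed.\<close>

text \<open>The measure is given only by its invariance, with no density or integration formula, so
  every integral over the sphere is reached by averaging over unitary maps. The exponent 2n/p is the
  one for which cmod H to the power p carries the same factor cmod (1 - <x,a>) to the power -2n as
  P. Since H takes the value 1 at \<open>a\<close>, equality in Jensen means that g / H is constant,
  equal to g(a). Division by H is harmless because H is holomorphic and zero-free wherever norm z *
  norm a < 1, which reaches beyond the closed ball; only g has to be dilated. The price is that the
  quotient takes the value g(ra), not g(a), at \<open>a\<close>. The tangent plane is nevertheless
  taken at the fixed point g(a): the error is linear in g(ra) - g(a) and vanishes by continuity at
  an interior point. For uniqueness a small mean defect must control a mean distance although the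
  quotients need not be bounded uniformly in r. This is why the convexity estimate has the form cmod
  (w - c) \<le> \<epsilon> + C * excess, with C independent of w and r.\<close>

unbundle no fps_syntax

section \<open>The Hermitian product and unitary maps adapted to a line\<close>

lemma scaleR_eq_smult: "r *\<^sub>R (x :: complex ^ 'n) = complex_of_real r *s x"
  by (simp add: vec_eq_iff scaleR_conv_of_real[where 'a = complex])

lemma herm_inner_add_left: "herm_inner (x + y) w = herm_inner x w + herm_inner y w"
  by (simp add: herm_inner_def sum.distrib distrib_right)

lemma herm_inner_diff_left: "herm_inner (x - y) w = herm_inner x w - herm_inner y w"
  by (simp add: herm_inner_def sum_subtractf left_diff_distrib)

lemma herm_inner_smult_left: "herm_inner (c *s x) w = c * herm_inner x w"
  by (simp add: herm_inner_def sum_distrib_left mult.assoc)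

lemma herm_inner_scaleR_left: "herm_inner (r *\<^sub>R x) w = of_real r * herm_inner x w"
  by (simp add: scaleR_eq_smult herm_inner_smult_left)

lemma cnj_herm_inner: "cnj (herm_inner z w) = herm_inner w z"
  by (simp add: herm_inner_def mult.commute)

lemma herm_inner_add_right: "herm_inner w (x + y) = herm_inner w x + herm_inner w y"
  by (simp add: herm_inner_def sum.distrib distrib_left)

lemma herm_inner_smult_right: "herm_inner w (c *s x) = cnj c * herm_inner w x"
  by (simp add: herm_inner_def sum_distrib_left mult_ac)

lemma herm_inner_scaleR_right: "herm_inner w (r *\<^sub>R x) = of_real r * herm_inner w x"
  by (simp add: scaleR_eq_smult herm_inner_smult_right)

lemma herm_inner_axis_right: "herm_inner w (axis i 1) = w $ i"
proof -
  have "herm_inner w (axis i 1) = (\<Sum>j\<in>UNIV. if j = i then w $ j else 0)"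
    unfolding herm_inner_def by (intro sum.cong) (auto simp: axis_def)
  then show ?thesis by simp
qed

lemma norm_smult_vec: "norm (c *s (x :: complex ^ 'n)) = cmod c * norm x"
  unfolding norm_vec_def by (simp add: norm_mult L2_set_right_distrib)

lemma inner_eq_Re_herm_inner: "inner z w = Re (herm_inner z w)" for z w :: "complex ^ 'n"
  by (simp add: inner_vec_def herm_inner_def inner_complex_def)

text \<open>Multiplying \<open>z\<close> by a unimodular constant makes the product real and
  nonnegative, which reduces the claim to the Cauchy-Schwarz inequality of the real inner
  product.\<close>

lemma norm_herm_inner_le: "cmod (herm_inner z w) \<le> norm z * norm w"
proof (cases "herm_inner z w = 0")
  case False
  define c where "c = cnj (sgn (herm_inner z w))"
  have c1: "cmod c = 1" using False by (simp add: c_def norm_sgn)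
  have "cmod (herm_inner z w) = Re (c * herm_inner z w)"
    using False
    by (simp add: c_def sgn_eq mult.commute complex_norm_square[symmetric] power2_eq_square
        flip: of_real_mult)
  also have "\<dots> = inner (c *s z) w"
    by (simp add: inner_eq_Re_herm_inner herm_inner_smult_left)
  also have "\<dots> \<le> norm (c *s z) * norm w" by (rule norm_cauchy_schwarz)
  finally show ?thesis by (simp add: norm_smult_vec c1)
qed simp

lemma norm_orth_decomp:
  fixes u w :: "complex ^ 'n"
  assumes "norm u = 1" "herm_inner w u = 0"
  shows "(norm (\<alpha> *s u + w))\<^sup>2 = (cmod \<alpha>)\<^sup>2 + (norm w)\<^sup>2"
proof -
  have "herm_inner u w = 0" using assms(2) cnj_herm_inner[of w u] by simp
  then have "complex_of_real ((norm (\<alpha> *s u + w))\<^sup>2) = of_real ((cmod \<alpha>)\<^sup>2 + (norm w)\<^sup>2)"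
    unfolding herm_inner_self[symmetric] of_real_add complex_norm_square
    by (simp add: herm_inner_add_left herm_inner_add_right herm_inner_smult_left
        herm_inner_smult_right assms herm_inner_self[of u])
  then show ?thesis using of_real_eq_iff by blast
qed

text \<open>For a unit vector \<open>u\<close> this is the map with eigenvalue \<open>c\<close> on
  the complex line of \<open>u\<close> and \<open>d\<close> on its orthogonal complement. The choice
  \<open>c = 1\<close> serves to average out the complement, \<open>d = 1\<close> to separate powers
  of the coordinate along \<open>u\<close>.\<close>

definition rot :: "complex ^ 'n \<Rightarrow> complex \<Rightarrow> complex \<Rightarrow> complex ^ 'n \<Rightarrow> complex ^ 'n" where
  "rot u c d x = (c * herm_inner x u) *s u + d *s (x - herm_inner x u *s u)"

lemma herm_inner_orth_part:
  assumes "norm u = 1"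
  shows "herm_inner (x - herm_inner x u *s u) u = 0"
  by (simp add: herm_inner_diff_left herm_inner_smult_left herm_inner_self assms)

lemma herm_inner_rot:
  assumes "norm u = 1"
  shows "herm_inner (rot u c d x) u = c * herm_inner x u"
  by (simp add: rot_def herm_inner_add_left herm_inner_smult_left herm_inner_self
      herm_inner_orth_part assms del: vector_ssub_ldistrib)

lemma orthogonal_transformation_rot:
  assumes u: "norm u = 1" and "cmod c = 1" "cmod d = 1"
  shows "orthogonal_transformation (rot u c d)"
  unfolding orthogonal_transformation
proof
  show "linear (rot u c d)"
    by (rule linearI)
      (simp_all add: rot_def vec_eq_iff herm_inner_add_left herm_inner_scaleR_left
        algebra_simps scaleR_conv_of_real[where 'a = complex])
  have "norm (rot u c d x) = norm x" for x
  proof -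
    define y where "y = x - herm_inner x u *s u"
    have y: "herm_inner y u = 0" unfolding y_def using u by (rule herm_inner_orth_part)
    then have dy: "herm_inner (d *s y) u = 0" by (simp add: herm_inner_smult_left)
    have "(norm (rot u c d x))\<^sup>2 = (cmod (c * herm_inner x u))\<^sup>2 + (norm (d *s y))\<^sup>2"
      unfolding rot_def y_def[symmetric] by (rule norm_orth_decomp[OF u dy])
    also have "\<dots> = (cmod (herm_inner x u))\<^sup>2 + (norm y)\<^sup>2"
      by (simp add: norm_mult norm_smult_vec assms)
    also have "\<dots> = (norm (herm_inner x u *s u + y))\<^sup>2"
      by (rule norm_orth_decomp[OF u y, symmetric])
    also have "herm_inner x u *s u + y = x" by (simp add: y_def)
    finally show ?thesis by simp
  qed
  then show "\<forall>x. norm (rot u c d x) = norm x" by blast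
qed

section \<open>Continuity and holomorphy in several variables\<close>

lemma continuous_on_herm_inner [continuous_intros]:
  assumes "continuous_on S f" "continuous_on S g"
  shows "continuous_on S (\<lambda>x. herm_inner (f x) (g x))"
  unfolding herm_inner_def by (intro continuous_intros assms)

lemma continuous_on_smult_vec [continuous_intros]:
  fixes f :: "'a::topological_space \<Rightarrow> complex" and g :: "'a \<Rightarrow> complex ^ 'n"
  assumes "continuous_on S f" "continuous_on S g"
  shows "continuous_on S (\<lambda>x. f x *s g x)"
  unfolding vector_scalar_mult_def by (intro continuous_intros assms)

lemma holomorphic_vec_on_subset:
  "f holomorphic_vec_on U \<Longrightarrow> V \<subseteq> U \<Longrightarrow> f holomorphic_vec_on V"
  unfolding holomorphic_vec_on_def by blast

lemma holomorphic_vec_on_imp_continuous_on: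
  "f holomorphic_vec_on U \<Longrightarrow> continuous_on U f"
  unfolding holomorphic_vec_on_def
  by (metis continuous_at_imp_continuous_on has_derivative_continuous)

lemma holomorphic_vec_on_const: "(\<lambda>z. c) holomorphic_vec_on U"
  unfolding holomorphic_vec_on_def by (auto intro!: exI[of _ "\<lambda>_. 0"] has_derivative_const)

lemma holomorphic_vec_on_mult:
  assumes "f holomorphic_vec_on U" "g holomorphic_vec_on U"
  shows "(\<lambda>z. f z * g z) holomorphic_vec_on U"
  unfolding holomorphic_vec_on_def
proof
  fix z assume "z \<in> U"
  then obtain D E where "(f has_derivative D) (at z)" "\<forall>c v. D (c *s v) = c * D v"
    "(g has_derivative E) (at z)" "\<forall>c v. E (c *s v) = c * E v"
    using assms unfolding holomorphic_vec_on_def by blast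
  then show "\<exists>D. ((\<lambda>z. f z * g z) has_derivative D) (at z) \<and> (\<forall>c v. D (c *s v) = c * D v)"
    by (intro exI[of _ "\<lambda>h. f z * E h + D h * g z"] conjI has_derivative_mult)
      (simp_all add: algebra_simps)
qed

lemma holomorphic_vec_on_compose_field:
  assumes f: "f holomorphic_vec_on U" and g: "\<And>z. z \<in> U \<Longrightarrow> g field_differentiable at (f z)"
  shows "(\<lambda>z. g (f z)) holomorphic_vec_on U"
  unfolding holomorphic_vec_on_def
proof
  fix z assume z: "z \<in> U"
  then obtain D where D: "(f has_derivative D) (at z)" "\<forall>c v. D (c *s v) = c * D v"
    using f unfolding holomorphic_vec_on_def by blast
  obtain g' where "(g has_field_derivative g') (at (f z))"
    using g[OF z] unfolding field_differentiable_def by blast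
  then have "(g has_derivative (\<lambda>h. g' * h)) (at (f z))"
    by (simp add: has_field_derivative_def)
  from has_derivative_compose[OF D(1) this]
  show "\<exists>D. ((\<lambda>z. g (f z)) has_derivative D) (at z) \<and> (\<forall>c v. D (c *s v) = c * D v)"
    using D(2) by (intro exI[of _ "\<lambda>h. g' * D h"]) auto
qed

lemma has_derivative_smult_right:
  fixes v :: "complex ^ 'n"
  shows "((\<lambda>c. b + c *s v) has_derivative (\<lambda>c. c *s v)) F"
proof -
  have "linear (\<lambda>c. c *s v)"
    by (rule linearI) (simp_all add: vec_eq_iff algebra_simps)
  then have "bounded_linear (\<lambda>c. c *s v)" by (simp add: linear_conv_bounded_linear)
  from has_derivative_add[OF has_derivative_const bounded_linear_imp_has_derivative[OF this]]
  show ?thesis by simp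
qed

text \<open>Complex linearity of the derivative turns the restriction to a complex line into a
  holomorphic function of one variable; all one-variable theory enters through this lemma.\<close>

lemma holomorphic_on_slice:
  fixes b v :: "complex ^ 'n"
  assumes f: "f holomorphic_vec_on U" and S: "\<And>c. c \<in> S \<Longrightarrow> b + c *s v \<in> U"
  shows "(\<lambda>c. f (b + c *s v)) holomorphic_on S"
proof (rule holomorphic_onI)
  fix c assume "c \<in> S"
  then obtain D where D: "(f has_derivative D) (at (b + c *s v))" "\<forall>c v. D (c *s v) = c * D v"
    using f S unfolding holomorphic_vec_on_def by blast
  have "((\<lambda>c. f (b + c *s v)) has_derivative (\<lambda>h. D (h *s v))) (at c)"
    by (rule has_derivative_compose[OF has_derivative_smult_right D(1)])
  then have "((\<lambda>c. f (b + c *s v)) has_field_derivative D v) (at c)"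
    using D(2) by (simp add: has_field_derivative_def mult_commute_abs)
  then show "(\<lambda>c. f (b + c *s v)) field_differentiable at c within S"
    using field_differentiable_def field_differentiable_at_within by blast
qed

lemma holomorphic_vec_on_affine_herm_inner:
  fixes a :: "complex ^ 'n"
  shows "(\<lambda>z. b - herm_inner z a) holomorphic_vec_on U"
  unfolding holomorphic_vec_on_def
proof
  fix z :: "complex ^ 'n"
  have "linear (\<lambda>z. herm_inner z a)"
    by (rule linearI)
      (simp_all add: herm_inner_add_left herm_inner_scaleR_left
        scaleR_conv_of_real[where 'a = complex])
  then have "bounded_linear (\<lambda>z. herm_inner z a)" by (simp add: linear_conv_bounded_linear)
  from has_derivative_diff[OF has_derivative_const bounded_linear_imp_has_derivative[OF this]]
  have "((\<lambda>z. b - herm_inner z a) has_derivative (\<lambda>h. - herm_inner h a)) (at z)" by simp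
  then show "\<exists>D. ((\<lambda>z. b - herm_inner z a) has_derivative D) (at z) \<and>
      (\<forall>c v. D (c *s v) = c * D v)"
    by (intro exI[of _ "\<lambda>h. - herm_inner h a"]) (simp add: herm_inner_smult_left)
qed

lemma holomorphic_vec_on_scaleR:
  fixes f :: "complex ^ 'n \<Rightarrow> complex"
  assumes f: "f holomorphic_vec_on U" and V: "\<And>z. z \<in> V \<Longrightarrow> r *\<^sub>R z \<in> U"
  shows "(\<lambda>z. f (r *\<^sub>R z)) holomorphic_vec_on V"
  unfolding holomorphic_vec_on_def
proof
  fix z assume "z \<in> V"
  then obtain D where D: "(f has_derivative D) (at (r *\<^sub>R z))" "\<forall>c v. D (c *s v) = c * D v"
    using f V unfolding holomorphic_vec_on_def by blast
  have "((\<lambda>z. r *\<^sub>R z) has_derivative (\<lambda>h. r *\<^sub>R h)) (at z)"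
    by (intro derivative_intros)
  from has_derivative_compose[OF this D(1)]
  have "((\<lambda>z. f (r *\<^sub>R z)) has_derivative (\<lambda>h. D (r *\<^sub>R h))) (at z)" .
  moreover have "r *\<^sub>R (c *s v) = c *s (r *\<^sub>R v)" for c and v :: "complex ^ 'n"
    by (simp add: vec_eq_iff)
  ultimately show "\<exists>D. ((\<lambda>z. f (r *\<^sub>R z)) has_derivative D) (at z) \<and>
      (\<forall>c v. D (c *s v) = c * D v)"
    using D(2) by (intro exI[of _ "\<lambda>h. D (r *\<^sub>R h)"]) auto
qed

section \<open>Integration over the sphere and reduction to a complex line\<close>

lemma circle_mean_value:
  assumes "continuous_on (cball 0 1) g" "g holomorphic_on ball 0 1"
  shows "((\<lambda>t. g (cis (2 * pi * t))) has_integral g 0) {0..1}"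
proof -
  have "((\<lambda>u. g u / (u - 0)) has_contour_integral (2 * of_real pi * \<i> * g 0)) (circlepath 0 1)"
    by (rule Cauchy_integral_circlepath) (use assms in auto)
  then have "((\<lambda>t. 2 * of_real pi * \<i> * g (cis (2 * pi * t))) has_integral
      (2 * of_real pi * \<i> * g 0)) {0..1}"
    unfolding has_contour_integral vector_derivative_circlepath
    by (simp add: circlepath cis_conv_exp mult_ac)
  from has_integral_mult_right[OF this, of "1 / (2 * of_real pi * \<i>)"]
  show ?thesis by simp
qed

locale sphere_measure =
  fixes \<sigma> :: "(complex ^ 'n) measure"
  assumes rotation_invariant: "rotation_invariant_prob \<sigma>"
begin

sublocale prob_space \<sigma>
  using rotation_invariant by (simp add: rotation_invariant_prob_def)

lemma sets_sigma: "sets \<sigma> = sets (restrict_space borel (sphere 0 1))"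
  using rotation_invariant by (simp add: rotation_invariant_prob_def)

lemma space_sigma: "space \<sigma> = sphere 0 1"
  using sets_eq_imp_space_eq[OF sets_sigma] by (simp add: space_restrict_space)

lemma borel_measurable_sigma:
  fixes g :: "complex ^ 'n \<Rightarrow> 'b :: topological_space"
  assumes "continuous_on (sphere 0 1) g"
  shows "g \<in> borel_measurable \<sigma>"
  using borel_measurable_continuous_on_restrict[OF assms]
  by (simp add: measurable_cong_sets[OF sets_sigma refl])

lemma integrable_sigma:
  fixes g :: "complex ^ 'n \<Rightarrow> 'b :: {banach, second_countable_topology}"
  assumes "continuous_on (sphere 0 1) g"
  shows "integrable \<sigma> g"
proof -
  have "compact (g ` sphere 0 1)"
    using assms by (intro compact_continuous_image) auto
  then have "bounded (g ` sphere 0 1)" by (rule compact_imp_bounded)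
  then obtain B where "\<And>x. x \<in> sphere 0 1 \<Longrightarrow> norm (g x) \<le> B"
    unfolding bounded_iff by blast
  then show ?thesis
    using borel_measurable_sigma[OF assms]
    by (intro integrable_const_bound[of _ B]) (auto simp: space_sigma)
qed

text \<open>Invariance is assumed for images of sets. Applied to the inverse of \<open>T\<close> it
  says that the push-forward of \<open>\<sigma>\<close> under \<open>T\<close> is
  \<open>\<sigma>\<close>.\<close>

lemma integral_rotate:
  fixes g :: "complex ^ 'n \<Rightarrow> 'b :: {banach, second_countable_topology}"
  assumes T: "orthogonal_transformation T" and g: "continuous_on (sphere 0 1) g"
  shows "(\<integral>x. g (T x) \<partial>\<sigma>) = (\<integral>x. g x \<partial>\<sigma>)"
proof -
  have bT: "bij T" using T by (rule orthogonal_transformation_bij)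
  have linT: "linear T" using T by (simp add: orthogonal_transformation_def)
  have nT: "norm (T x) = norm x" for x using T by (rule orthogonal_transformation_norm)
  have "T \<in> borel_measurable \<sigma>"
    by (intro borel_measurable_sigma linear_continuous_on
        linear_conv_bounded_linear[THEN iffD1] linT)
  then have "T \<in> \<sigma> \<rightarrow>\<^sub>M restrict_space borel (sphere 0 1)"
    by (intro measurable_restrict_space2) (auto simp: space_sigma nT)
  then have Tm [measurable]: "T \<in> \<sigma> \<rightarrow>\<^sub>M \<sigma>"
    by (simp add: measurable_cong_sets[OF refl sets_sigma])
  have "distr \<sigma> \<sigma> T = \<sigma>"
  proof (rule measure_eqI)
    fix A assume "A \<in> sets (distr \<sigma> \<sigma> T)"
    then have A: "A \<in> sets \<sigma>" by simp
    have "emeasure (distr \<sigma> \<sigma> T) A = emeasure \<sigma> (T -` A \<inter> space \<sigma>)"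
      by (rule emeasure_distr[OF Tm A])
    also have "T -` A \<inter> space \<sigma> = inv T ` A"
      using bT sets.sets_into_space[OF A] nT
      by (auto simp: space_sigma bij_vimage_eq_inv_image[symmetric] subset_iff)
    also have "emeasure \<sigma> (inv T ` A) = emeasure \<sigma> A"
      using rotation_invariant orthogonal_transformation_inv[OF T] A
      by (simp add: rotation_invariant_prob_def)
    finally show "emeasure (distr \<sigma> \<sigma> T) A = emeasure \<sigma> A" .
  qed simp
  then have "(\<integral>x. g x \<partial>\<sigma>) = (\<integral>x. g x \<partial>distr \<sigma> \<sigma> T)" by simp
  also have "\<dots> = (\<integral>x. g (T x) \<partial>\<sigma>)"
    by (rule integral_distr[OF Tm borel_measurable_sigma[OF g]])
  finally show ?thesis by simp
qed

text \<open>Averaging over the rotations that fix \<open>u\<close> and multiply its orthogonal complement by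
  \<open>e\<^sup>i\<^sup>t\<close>, the mean value property replaces \<open>f\<close> by its restriction to the line through \<open>u\<close>.\<close>

lemma integral_slice:
  assumes u: "norm u = 1" and R: "1 < R" and f: "f holomorphic_vec_on ball 0 R"
    and k: "continuous_on (cball 0 1) k"
  shows "(\<integral>x. f x * k (herm_inner x u) \<partial>\<sigma>) =
    (\<integral>x. f (herm_inner x u *s u) * k (herm_inner x u) \<partial>\<sigma>)"
proof -
  define h where "h x t = f (rot u 1 (cis (2 * pi * t)) x) * k (herm_inner x u)" for x t
  \<comment> \<open>The average over the angle is itself a probability space, so a quantity that
    does not depend on \<open>t\<close> is unchanged by it, and Fubini applies to the product with
    \<open>\<sigma>\<close>.\<close>
  define I where "I = lebesgue_on {0..1::real}"
  have fc: "continuous_on (ball 0 R) f"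
    using f by (rule holomorphic_vec_on_imp_continuous_on)
  have Iprob: "prob_space I"
    by (rule prob_spaceI) (simp add: I_def emeasure_restrict_space)
  interpret I: prob_space I by (rule Iprob)
  interpret P: pair_prob_space \<sigma> I ..
  have orth: "orthogonal_transformation (rot u 1 (cis s))" for s
    by (rule orthogonal_transformation_rot[OF u]) auto
  have nrot: "norm (rot u 1 (cis s) x) = norm x" for s x
    using orth by (rule orthogonal_transformation_norm)
  have hu: "cmod (herm_inner x u) \<le> 1" if "norm x = 1" for x
    using norm_herm_inner_le[of x u] u that by simp
  have hc: "continuous_on (sphere 0 1 \<times> UNIV) (\<lambda>(x, t). h x t)"
  proof -
    have rc: "continuous_on UNIV (\<lambda>p. rot u 1 (cis (2 * pi * snd p)) (fst p))"
      unfolding rot_def cis_conv_exp by (intro continuous_intros)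
    have "continuous_on (sphere 0 1 \<times> UNIV)
        (\<lambda>p. f (rot u 1 (cis (2 * pi * snd p)) (fst p)) * k (herm_inner (fst p) u))"
      using R hu nrot
      by (intro continuous_on_mult continuous_on_compose2[OF fc continuous_on_subset[OF rc]]
          continuous_on_compose2[OF k] continuous_intros) auto
    then show ?thesis by (simp add: h_def split_def)
  qed
  \<comment> \<open>Continuity of \<open>h\<close> is known only over the sphere, so measurability
    is obtained through the Borel space restricted to
    \<open>sphere 0 1 \<times> UNIV\<close>.\<close>
  have hm: "(\<lambda>(x, t). h x t) \<in> borel_measurable (\<sigma> \<Otimes>\<^sub>M I)"
  proof -
    have "(\<lambda>x. x) \<in> \<sigma> \<rightarrow>\<^sub>M borel" by (intro borel_measurable_sigma continuous_intros)
    then have [measurable]: "fst \<in> \<sigma> \<Otimes>\<^sub>M I \<rightarrow>\<^sub>M borel"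
      using measurable_compose[OF measurable_fst] by auto
    have "(\<lambda>x. x) \<in> I \<rightarrow>\<^sub>M borel" unfolding I_def
      by (intro continuous_imp_measurable_on_sets_lebesgue continuous_intros) auto
    then have [measurable]: "snd \<in> \<sigma> \<Otimes>\<^sub>M I \<rightarrow>\<^sub>M borel"
      using measurable_compose[OF measurable_snd] by auto
    have "(\<lambda>p. (fst p, snd p)) \<in> \<sigma> \<Otimes>\<^sub>M I \<rightarrow>\<^sub>M (borel \<Otimes>\<^sub>M borel)" by measurable
    then have "(\<lambda>p. p) \<in> \<sigma> \<Otimes>\<^sub>M I \<rightarrow>\<^sub>M borel" by (simp add: borel_prod)
    then have "(\<lambda>p. p) \<in> \<sigma> \<Otimes>\<^sub>M I \<rightarrow>\<^sub>M restrict_space borel (sphere 0 1 \<times> UNIV)"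
      by (intro measurable_restrict_space2) (auto simp: space_pair_measure space_sigma)
    from measurable_compose[OF this borel_measurable_continuous_on_restrict[OF hc]]
    show ?thesis .
  qed
  have "compact ((\<lambda>(x, t). h x t) ` (sphere 0 1 \<times> {0..1}))"
    by (intro compact_continuous_image compact_Times continuous_on_subset[OF hc]) auto
  then have "bounded ((\<lambda>(x, t). h x t) ` (sphere 0 1 \<times> {0..1}))" by (rule compact_imp_bounded)
  then obtain B where B: "\<And>x t. x \<in> sphere 0 1 \<Longrightarrow> t \<in> {0..1} \<Longrightarrow> norm (h x t) \<le> B"
    unfolding bounded_iff by fast
  have int: "integrable (\<sigma> \<Otimes>\<^sub>M I) (\<lambda>(x, t). h x t)"
    using hm
    by (intro P.integrable_const_bound[of _ B] AE_I2)
      (auto simp: space_pair_measure space_sigma I_def space_restrict_space intro!: B)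
  \<comment> \<open>For fixed \<open>x\<close> the rotated points run through the circle of radius 1
    in the variable \<open>c\<close> of \<open>g\<close>. The whole closed disc is mapped into the
    closed unit ball by Pythagoras, and its centre is the projection of \<open>x\<close> to the line
    of \<open>u\<close>.\<close>
  have inner: "(\<integral>t. h x t \<partial>I) = f (herm_inner x u *s u) * k (herm_inner x u)"
    if x: "norm x = 1" for x
  proof -
    define w where "w = x - herm_inner x u *s u"
    define g where "g c = f (herm_inner x u *s u + c *s w)" for c
    have wu: "herm_inner w u = 0" unfolding w_def using u by (rule herm_inner_orth_part)
    have n1: "(cmod (herm_inner x u))\<^sup>2 + (norm w)\<^sup>2 = 1"
      using norm_orth_decomp[OF u wu, of "herm_inner x u"] x by (simp add: w_def)
    have "g holomorphic_on cball 0 1"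
      unfolding g_def
    proof (rule holomorphic_on_slice[OF f])
      fix c :: complex assume "c \<in> cball 0 1"
      then have c: "cmod c \<le> 1" by simp
      have "(norm (herm_inner x u *s u + c *s w))\<^sup>2 = (cmod (herm_inner x u))\<^sup>2 + (norm (c *s w))\<^sup>2"
        by (rule norm_orth_decomp[OF u]) (simp add: herm_inner_smult_left wu)
      also have "norm (c *s w) \<le> norm w"
        using c by (simp add: norm_smult_vec mult_left_le_one_le)
      then have "(norm (c *s w))\<^sup>2 \<le> (norm w)\<^sup>2" by (rule power_mono) simp
      then have "(cmod (herm_inner x u))\<^sup>2 + (norm (c *s w))\<^sup>2 \<le> 1" using n1 by linarith
      finally have "norm (herm_inner x u *s u + c *s w) \<le> 1"
        by (simp add: power_le_one_iff)
      then show "herm_inner x u *s u + c *s w \<in> ball 0 R" using R by simp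
    qed
    then have "((\<lambda>t. g (cis (2 * pi * t))) has_integral g 0) {0..1}"
      by (intro circle_mean_value)
        (auto intro: holomorphic_on_imp_continuous_on holomorphic_on_subset)
    from has_integral_mult_left[OF this, of "k (herm_inner x u)"]
    have hi: "(h x has_integral (f (herm_inner x u *s u) * k (herm_inner x u))) {0..1}"
      by (simp add: g_def h_def[abs_def] rot_def w_def)
    have "continuous_on {0..1} (\<lambda>t. (\<lambda>(x, t). h x t) (x, t))"
      using x by (intro continuous_on_compose2[OF hc] continuous_intros) auto
    then have "continuous_on {0..1} (h x)" by simp
    then have "integrable I (h x)"
      unfolding I_def by (rule continuous_imp_integrable_real)
    then have "(\<integral>t. h x t \<partial>I) = integral {0..1} (h x)"
      unfolding I_def by (intro lebesgue_integral_eq_integral) auto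
    then show ?thesis using hi by (simp add: integral_unique)
  qed
  have outer: "(\<integral>x. h x t \<partial>\<sigma>) = (\<integral>x. f x * k (herm_inner x u) \<partial>\<sigma>)" for t
  proof -
    have "(\<integral>x. h x t \<partial>\<sigma>) = (\<integral>x. (\<lambda>x. f x * k (herm_inner x u)) (rot u 1 (cis (2 * pi * t)) x) \<partial>\<sigma>)"
      by (simp add: h_def herm_inner_rot[OF u])
    also have "\<dots> = (\<integral>x. f x * k (herm_inner x u) \<partial>\<sigma>)"
      using R hu
      by (intro integral_rotate orth continuous_on_mult continuous_on_subset[OF fc]
          continuous_on_compose2[OF k] continuous_intros) auto
    finally show ?thesis .
  qed
  have "(\<integral>x. f x * k (herm_inner x u) \<partial>\<sigma>) = (\<integral>t. \<integral>x. h x t \<partial>\<sigma> \<partial>I)"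
    by (simp add: outer I.prob_space)
  also have "\<dots> = (\<integral>x. \<integral>t. h x t \<partial>I \<partial>\<sigma>)"
    by (rule P.Fubini_integral[OF int])
  also have "\<dots> = (\<integral>x. f (herm_inner x u *s u) * k (herm_inner x u) \<partial>\<sigma>)"
    by (intro Bochner_Integration.integral_cong) (auto simp: space_sigma inner)
  finally show ?thesis .
qed

end

section \<open>Moments of a linear coordinate on the sphere\<close>

lemma holomorphic_vec_on_herm_inner_power:
  fixes a :: "complex ^ 'n"
  shows "(\<lambda>z. herm_inner z a ^ k) holomorphic_vec_on U"
proof -
  have "(\<lambda>z. (- (0 - herm_inner z a)) ^ k) holomorphic_vec_on U"
    by (rule holomorphic_vec_on_compose_field[OF holomorphic_vec_on_affine_herm_inner])
      (auto intro!: derivative_intros)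
  then show ?thesis by simp
qed

lemma holomorphic_vec_on_herm_inner:
  fixes a :: "complex ^ 'n"
  shows "(\<lambda>z. herm_inner z a) holomorphic_vec_on U"
  using holomorphic_vec_on_herm_inner_power[of a 1] by simp

lemma herm_inner_rot_orth:
  assumes "herm_inner u v = 0"
  shows "herm_inner (rot u c 1 x) v = herm_inner x v"
  using assms by (simp add: rot_def herm_inner_add_left herm_inner_diff_left herm_inner_smult_left)

lemma negative_binomial_sums:
  fixes y :: complex
  assumes "cmod y < 1"
  shows "(\<lambda>k. pochhammer (of_nat n) k / fact k * y ^ k) sums inverse ((1 - y) ^ n)"
proof -
  have "1 - y \<noteq> 0" using assms by auto
  then have "(1 + (- y)) powr (- of_nat n) = inverse ((1 - y) ^ n)"
    by (simp add: powr_minus powr_nat)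
  moreover have "((- of_nat n) gchoose k) * (- y) ^ k = pochhammer (of_nat n) k / fact k * y ^ k" for k
    unfolding gbinomial_pochhammer power_minus[of y]
    by (simp add: mult_ac)
  ultimately show ?thesis
    using gen_binomial_complex[of "- y" "- of_nat n"] assms by simp
qed

lemma cis_power_mult_cnj_power: "cis t ^ j * cnj (cis t) ^ k = cis ((real j - real k) * t)"
  by (simp add: Complex.DeMoivre cis_cnj cis_mult left_diff_distrib)

lemma cis_separates_powers:
  assumes "j \<noteq> k"
  obtains t where "cis t ^ j * cnj (cis t) ^ k \<noteq> 1"
proof
  have "real j - real k \<noteq> 0" using assms by simp
  \<comment> \<open>With this angle the product is \<open>cis pi = -1\<close>.\<close>
  then show "cis (pi / (real j - real k)) ^ j * cnj (cis (pi / (real j - real k))) ^ k \<noteq> 1"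
    by (simp add: cis_power_mult_cnj_power)
qed

context sphere_measure
begin

lemma integral_eq_0_of_rotate:
  fixes g :: "complex ^ 'n \<Rightarrow> complex"
  assumes T: "orthogonal_transformation T" and g: "continuous_on (sphere 0 1) g"
    and "\<And>x. g (T x) = c * g x" "c \<noteq> 1"
  shows "(\<integral>x. g x \<partial>\<sigma>) = 0"
proof -
  have "(\<integral>x. g x \<partial>\<sigma>) = c * (\<integral>x. g x \<partial>\<sigma>)"
    using integral_rotate[OF T g] assms(3) by simp
  then show ?thesis using \<open>c \<noteq> 1\<close> by simp
qed

text \<open>Turning the coordinate along \<open>u\<close> by a phase multiplies the integrand by a
  constant other than 1. The invariant factor \<open>g\<close> makes room for powers of coordinates
  orthogonal to \<open>u\<close>.\<close>

lemma integral_monomial_orthogonal: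
  assumes u: "norm u = 1" and "j \<noteq> k"
    and g: "continuous_on (sphere 0 1) g" "\<And>x c. cmod c = 1 \<Longrightarrow> g (rot u c 1 x) = g x"
  shows "(\<integral>x. g x * (herm_inner x u ^ j * cnj (herm_inner x u) ^ k) \<partial>\<sigma>) = 0"
proof -
  obtain t where t: "cis t ^ j * cnj (cis t) ^ k \<noteq> 1"
    using cis_separates_powers[OF \<open>j \<noteq> k\<close>] .
  show ?thesis
    by (rule integral_eq_0_of_rotate[OF orthogonal_transformation_rot[OF u, of "cis t" 1] _ _ t])
      (auto simp: g(2) herm_inner_rot[OF u] power_mult_distrib intro!: continuous_intros g(1))
qed

definition moment :: "complex ^ 'n \<Rightarrow> nat \<Rightarrow> complex" where
  "moment u k = (\<integral>x. herm_inner x u ^ k * cnj (herm_inner x u) ^ k \<partial>\<sigma>)"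

lemma cnj_moment: "cnj (moment u k) = moment u k"
  unfolding moment_def Bochner_Integration.integral_cnj[symmetric] by (simp add: mult.commute)

lemma moment_0: "moment u 0 = 1"
  by (simp add: moment_def prob_space)

lemma integral_power_slice:
  assumes "norm u = 1"
  shows "(\<integral>x. herm_inner x w ^ k * cnj (herm_inner x u) ^ k \<partial>\<sigma>) = herm_inner u w ^ k * moment u k"
proof -
  have "(\<integral>x. herm_inner x w ^ k * cnj (herm_inner x u) ^ k \<partial>\<sigma>) =
      (\<integral>x. herm_inner (herm_inner x u *s u) w ^ k * cnj (herm_inner x u) ^ k \<partial>\<sigma>)"
    by (rule integral_slice[OF assms, of 2 "\<lambda>x. herm_inner x w ^ k" "\<lambda>y. cnj y ^ k"])
      (auto intro!: holomorphic_vec_on_herm_inner_power continuous_intros)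
  also have "\<dots> = (\<integral>x. herm_inner u w ^ k * (herm_inner x u ^ k * cnj (herm_inner x u) ^ k) \<partial>\<sigma>)"
    by (simp add: herm_inner_smult_left power_mult_distrib mult_ac)
  finally show ?thesis by (simp add: moment_def)
qed

text \<open>One integral, of \<open>herm_inner x v ^ k\<close> against the conjugate of
  \<open>herm_inner x u ^ k\<close>, is sliced along \<open>u\<close> and, after conjugation, along
  \<open>v\<close>. This compares the moments without a unitary map taking \<open>u\<close> to
  \<open>v\<close>.\<close>

lemma moment_eq_if_not_orthogonal:
  assumes "norm u = 1" "norm v = 1" "herm_inner u v \<noteq> 0"
  shows "moment u k = moment v k"
proof -
  have "herm_inner u v ^ k * moment u k = (\<integral>x. herm_inner x v ^ k * cnj (herm_inner x u) ^ k \<partial>\<sigma>)"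
    using integral_power_slice[OF assms(1)] by simp
  also have "\<dots> = cnj (\<integral>x. herm_inner x u ^ k * cnj (herm_inner x v) ^ k \<partial>\<sigma>)"
    unfolding Bochner_Integration.integral_cnj[symmetric] by (simp add: mult.commute)
  also have "\<dots> = herm_inner u v ^ k * moment v k"
    unfolding integral_power_slice[OF assms(2)] by (simp add: cnj_moment cnj_herm_inner)
  finally show ?thesis using assms(3) by simp
qed

lemma moment_eq:
  assumes u: "norm u = 1" and v: "norm v = 1"
  shows "moment u k = moment v k"
proof (cases "herm_inner u v = 0")
  case orth: True
  then have vu: "herm_inner v u = 0" using cnj_herm_inner[of u v] by simp
  \<comment> \<open>The normalised sum is orthogonal to neither vector, so it links the two moments
    by the previous case applied twice.\<close>
  define w where "w = (1 / sqrt 2) *\<^sub>R (u + v)"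
  have "(norm (u + v))\<^sup>2 = 2"
    using norm_orth_decomp[OF u vu, of 1] v by simp
  then have "norm (u + v) = sqrt 2" by (simp add: real_sqrt_unique)
  then have w: "norm w = 1" by (simp add: w_def)
  have "herm_inner u w \<noteq> 0" "herm_inner w v \<noteq> 0"
    by (simp_all add: w_def herm_inner_scaleR_right herm_inner_scaleR_left herm_inner_add_right
        herm_inner_add_left orth herm_inner_self u v)
  then show ?thesis
    using moment_eq_if_not_orthogonal u v w by metis
qed (rule moment_eq_if_not_orthogonal[OF assms])

text \<open>Both sides come from the integral of \<open>\<langle>x,u\<rangle>\<^sup>k \<langle>x,v\<rangle>\<close> against the conjugate of
  \<open>\<langle>x,u + v\<rangle>\<^sup>k\<^sup>+\<^sup>1\<close>: slicing along \<open>u + v\<close> gives the moment, expanding the power leaves by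
  orthogonality a single term.\<close>

lemma mixed_moment:
  assumes u: "norm u = 1" and v: "norm v = 1" and uv: "herm_inner u v = 0"
  shows "of_nat (Suc k) * (\<integral>x. herm_inner x u ^ k * cnj (herm_inner x u) ^ k *
      (herm_inner x v * cnj (herm_inner x v)) \<partial>\<sigma>) = moment u (Suc k)"
proof -
  have vu: "herm_inner v u = 0" using uv cnj_herm_inner[of u v] by simp
  define s where "s = complex_of_real (sqrt 2)"
  have s: "s \<noteq> 0" "cnj s = s" by (simp_all add: s_def)
  define w where "w = (1 / sqrt 2) *\<^sub>R (u + v)"
  have "(norm (u + v))\<^sup>2 = 2"
    using norm_orth_decomp[OF u vu, of 1] v by simp
  then have "norm (u + v) = sqrt 2" by (simp add: real_sqrt_unique)
  then have w: "norm w = 1" by (simp add: w_def)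
  have wu: "herm_inner w u = 1 / s" and wv: "herm_inner w v = 1 / s"
    by (simp_all add: w_def s_def herm_inner_scaleR_left herm_inner_add_left uv vu herm_inner_self u v)
  have xuv: "herm_inner x u + herm_inner x v = s * herm_inner x w" for x
    using s(1) by (simp add: w_def s_def herm_inner_scaleR_right herm_inner_add_right)
  define I where "I = (\<integral>x. (herm_inner x u ^ k * herm_inner x v) *
      cnj (herm_inner x u + herm_inner x v) ^ Suc k \<partial>\<sigma>)"
  have "I = (\<integral>x. (herm_inner x u ^ k * herm_inner x v) * (cnj (s * herm_inner x w)) ^ Suc k \<partial>\<sigma>)"
    by (simp add: I_def xuv)
  also have "\<dots> = (\<integral>x. (herm_inner (herm_inner x w *s w) u ^ k * herm_inner (herm_inner x w *s w) v)
      * (cnj (s * herm_inner x w)) ^ Suc k \<partial>\<sigma>)"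
    by (rule integral_slice[OF w, of 2 "\<lambda>x. herm_inner x u ^ k * herm_inner x v"
          "\<lambda>y. (cnj (s * y)) ^ Suc k"])
      (auto intro!: holomorphic_vec_on_mult holomorphic_vec_on_herm_inner_power
        holomorphic_vec_on_herm_inner continuous_intros simp del: power_Suc)
  \<comment> \<open>The \<open>k + 1\<close> factors \<open>1 / s\<close> from the projections onto
    \<open>w\<close> cancel the \<open>k + 1\<close> factors \<open>s\<close> in the conjugated
    power.\<close>
  also have "\<dots> = (\<integral>x. herm_inner x w ^ Suc k * cnj (herm_inner x w) ^ Suc k \<partial>\<sigma>)"
    using s by (simp add: herm_inner_smult_left wu wv power_mult_distrib power_divide field_simps)
  finally have I1: "I = moment u (Suc k)"
    unfolding moment_eq[OF u w] unfolding moment_def .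
  define J where "J l = (\<integral>x. herm_inner x u ^ k * cnj (herm_inner x u) ^ (Suc k - l) *
      (herm_inner x v ^ 1 * cnj (herm_inner x v) ^ l) \<partial>\<sigma>)" for l
  have "I = (\<integral>x. (\<Sum>l\<le>Suc k. of_nat (Suc k choose l) *
      (herm_inner x u ^ k * cnj (herm_inner x u) ^ (Suc k - l) *
      (herm_inner x v ^ 1 * cnj (herm_inner x v) ^ l))) \<partial>\<sigma>)"
    unfolding I_def complex_cnj_add add.commute[of "cnj (herm_inner _ u)"] binomial_ring
    by (simp add: sum_distrib_left mult_ac del: sum.atMost_Suc)
  also have "\<dots> = (\<Sum>l\<le>Suc k. of_nat (Suc k choose l) * J l)"
    unfolding J_def
    by (subst Bochner_Integration.integral_sum)
      (auto intro!: integrable_sigma continuous_intros simp del: sum.atMost_Suc)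
  \<comment> \<open>The coordinate along \<open>v\<close> occurs to the first power, so only its
    first conjugate power survives; the binomial coefficient there is the factor
    \<open>Suc k\<close> of the statement.\<close>
  also have "\<dots> = (\<Sum>l\<in>{1}. of_nat (Suc k choose l) * J l)"
  proof (intro sum.mono_neutral_right ballI)
    fix l assume "l \<in> {..Suc k} - {1}"
    then have l: "1 \<noteq> l" by auto
    have "J l = 0"
      unfolding J_def using l v
      by (intro integral_monomial_orthogonal)
        (auto intro!: continuous_intros simp: herm_inner_rot_orth[OF vu])
    then show "of_nat (Suc k choose l) * J l = 0" by simp
  qed auto
  finally show ?thesis using I1 by (simp add: J_def)
qed

text \<open>On the sphere the squared moduli of the coordinates add up to 1. Inserting this sum
  gives the next moment once, from the coordinate already present, and n - 1 mixed moments, each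
  equal to the next moment divided by \<open>Suc k\<close>.\<close>

lemma moment_Suc:
  assumes u: "norm u = 1"
  shows "moment u k * of_nat (Suc k) = moment u (Suc k) * of_nat (CARD('n) + k)"
proof -
  \<comment> \<open>Any coordinate will do; \<open>moment_eq\<close> transfers the result to
    \<open>u\<close> at the end.\<close>
  define i :: 'n where "i = undefined"
  define e :: "'n \<Rightarrow> complex ^ 'n" where "e j = axis j 1" for j
  have e: "norm (e j) = 1" for j by (simp add: e_def)
  have eo: "herm_inner (e i) (e j) = 0" if "i \<noteq> j" for i j
    using that by (simp add: e_def herm_inner_axis_right) (simp add: axis_def)
  define X where "X x = herm_inner x (e i) ^ k * cnj (herm_inner x (e i)) ^ k" for x
  have "moment (e i) k = (\<integral>x. X x * (\<Sum>j\<in>UNIV. herm_inner x (e j) * cnj (herm_inner x (e j))) \<partial>\<sigma>)"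
    unfolding moment_def X_def
  proof (rule Bochner_Integration.integral_cong[OF refl])
    fix x assume "x \<in> space \<sigma>"
    then have "herm_inner x x = 1" by (simp add: space_sigma herm_inner_self)
    then have "(\<Sum>j\<in>UNIV. herm_inner x (e j) * cnj (herm_inner x (e j))) = 1"
      by (simp add: e_def herm_inner_axis_right) (simp add: herm_inner_def)
    then show "herm_inner x (e i) ^ k * cnj (herm_inner x (e i)) ^ k =
        herm_inner x (e i) ^ k * cnj (herm_inner x (e i)) ^ k *
        (\<Sum>j\<in>UNIV. herm_inner x (e j) * cnj (herm_inner x (e j)))"
      by simp
  qed
  also have "\<dots> = (\<Sum>j\<in>UNIV. \<integral>x. X x * (herm_inner x (e j) * cnj (herm_inner x (e j))) \<partial>\<sigma>)"
    unfolding sum_distrib_left X_def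
    by (intro Bochner_Integration.integral_sum integrable_sigma continuous_intros)
  also have "\<dots> = (\<integral>x. X x * (herm_inner x (e i) * cnj (herm_inner x (e i))) \<partial>\<sigma>) +
      (\<Sum>j\<in>UNIV - {i}. \<integral>x. X x * (herm_inner x (e j) * cnj (herm_inner x (e j))) \<partial>\<sigma>)"
    by (rule sum.remove) auto
  also have "(\<integral>x. X x * (herm_inner x (e i) * cnj (herm_inner x (e i))) \<partial>\<sigma>) = moment (e i) (Suc k)"
    by (simp add: X_def moment_def mult_ac)
  also have "(\<Sum>j\<in>UNIV - {i}. \<integral>x. X x * (herm_inner x (e j) * cnj (herm_inner x (e j))) \<partial>\<sigma>) =
      (\<Sum>j\<in>UNIV - {i}. moment (e i) (Suc k) / of_nat (Suc k))"
  proof (rule sum.cong[OF refl])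
    fix j assume "j \<in> UNIV - {i}"
    then have "herm_inner (e i) (e j) = 0" by (intro eo) auto
    from mixed_moment[OF e e this, of k]
    show "(\<integral>x. X x * (herm_inner x (e j) * cnj (herm_inner x (e j))) \<partial>\<sigma>) =
        moment (e i) (Suc k) / of_nat (Suc k)"
      unfolding X_def by (simp add: field_simps del: of_nat_Suc)
  qed
  also have "\<dots> = of_nat (CARD('n) - 1) * (moment (e i) (Suc k) / of_nat (Suc k))"
    by (simp add: card_Diff_singleton)
  finally have "moment (e i) k * of_nat (Suc k) =
      moment (e i) (Suc k) * (of_nat (Suc k) + of_nat (CARD('n) - 1))"
    by (simp add: field_simps del: of_nat_Suc)
  also have "of_nat (Suc k) + of_nat (CARD('n) - 1) = (of_nat (CARD('n) + k) :: complex)"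
    by (simp flip: of_nat_add)
  finally show ?thesis using moment_eq[OF u e] by metis
qed

text \<open>The moments are exactly the reciprocals of the Taylor coefficients of
  \<open>(1 - y)\<close> to the power -n. This is what makes that kernel reproduce powers.\<close>

lemma moment_pochhammer:
  assumes "norm u = 1"
  shows "moment u k * pochhammer (of_nat CARD('n)) k = fact k"
proof (induction k)
  case (Suc k)
  have "moment u (Suc k) * pochhammer (of_nat CARD('n)) (Suc k) =
      (moment u (Suc k) * of_nat (CARD('n) + k)) * pochhammer (of_nat CARD('n)) k"
    by (simp add: pochhammer_Suc mult_ac)
  also have "\<dots> = of_nat (Suc k) * (moment u k * pochhammer (of_nat CARD('n)) k)"
    unfolding moment_Suc[OF assms, symmetric] by (simp add: mult_ac)
  finally show ?case by (simp add: Suc.IH)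
qed (simp add: moment_0)

end

section \<open>Cauchy and Poisson formulas on the ball\<close>

text \<open>This is the invariant (Poisson-Szego) kernel, not the harmonic one of the real ball. The
  formula is kept for all \<open>x\<close>, since it is also evaluated at
  \<open>r *\<^sub>R x\<close> inside the ball.\<close>

definition poisson_kernel :: "complex ^ 'n \<Rightarrow> complex ^ 'n \<Rightarrow> real" where
  "poisson_kernel a x = ((1 - (norm a)\<^sup>2) / (cmod (1 - herm_inner x a))\<^sup>2) ^ CARD('n)"

context sphere_measure
begin

text \<open>Termwise integration, with the absolute series as majorant. The base \<open>e\<close> is
  later the coordinate along \<open>u\<close>, for the series of \<open>f\<close>, or its conjugate,
  for the series of the kernel.\<close>

lemma integral_power_series:
  fixes e g :: "complex ^ 'n \<Rightarrow> complex"
  assumes a: "summable (\<lambda>j. cmod (a j))"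
    and e: "continuous_on (sphere 0 1) e" "\<And>x. x \<in> sphere 0 1 \<Longrightarrow> cmod (e x) \<le> 1"
    and g: "continuous_on (sphere 0 1) g"
  shows "(\<lambda>j. a j * (\<integral>x. e x ^ j * g x \<partial>\<sigma>)) sums (\<integral>x. (\<Sum>j. a j * e x ^ j) * g x \<partial>\<sigma>)"
proof -
  have le: "cmod (a j * e x ^ j) \<le> cmod (a j)" if "x \<in> sphere 0 1" for x j
    using e(2)[OF that] by (simp add: norm_mult norm_power mult_left_le power_le_one)
  have le': "cmod (a j * e x ^ j * g x) \<le> cmod (a j) * cmod (g x)" if "x \<in> sphere 0 1" for x j
    using le[OF that, of j] by (simp add: norm_mult mult_right_mono)
  have int: "integrable \<sigma> (\<lambda>x. a j * e x ^ j * g x)" for j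
    by (intro integrable_sigma continuous_intros e g)
  have "(\<lambda>j. \<integral>x. a j * e x ^ j * g x \<partial>\<sigma>) sums (\<integral>x. (\<Sum>j. a j * e x ^ j * g x) \<partial>\<sigma>)"
  proof (rule sums_integral)
    show "AE x in \<sigma>. summable (\<lambda>j. norm (a j * e x ^ j * g x))"
      using le' by (intro AE_I2 summable_comparison_test'[OF summable_mult2[OF a]])
        (simp add: space_sigma)
    show "summable (\<lambda>j. \<integral>x. norm (a j * e x ^ j * g x) \<partial>\<sigma>)"
    proof (rule summable_comparison_test'[OF summable_mult2[OF a]])
      fix j
      have "(\<integral>x. norm (a j * e x ^ j * g x) \<partial>\<sigma>) \<le> (\<integral>x. cmod (a j) * cmod (g x) \<partial>\<sigma>)"
        by (intro integral_mono integrable_norm[OF int] integrable_sigma continuous_intros g)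
          (use le' in \<open>simp add: space_sigma\<close>)
      then show "norm (\<integral>x. norm (a j * e x ^ j * g x) \<partial>\<sigma>) \<le> cmod (a j) * (\<integral>x. cmod (g x) \<partial>\<sigma>)"
        by (simp add: norm_mult)
    qed
  qed (rule int)
  moreover have "(\<integral>x. (\<Sum>j. a j * e x ^ j * g x) \<partial>\<sigma>) = (\<integral>x. (\<Sum>j. a j * e x ^ j) * g x \<partial>\<sigma>)"
  proof (rule Bochner_Integration.integral_cong[OF refl])
    fix x assume "x \<in> space \<sigma>"
    then have "summable (\<lambda>j. cmod (a j * e x ^ j))"
      using le by (intro summable_comparison_test'[OF a]) (simp add: space_sigma)
    then show "(\<Sum>j. a j * e x ^ j * g x) = (\<Sum>j. a j * e x ^ j) * g x"
      by (rule suminf_mult2[OF summable_norm_cancel, symmetric])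
  qed
  moreover have "(\<integral>x. a j * e x ^ j * g x \<partial>\<sigma>) = a j * (\<integral>x. e x ^ j * g x \<partial>\<sigma>)" for j
    by (simp add: mult.assoc)
  ultimately show ?thesis by simp
qed

text \<open>After expansion of the kernel, orthogonality leaves the term of index \<open>j\<close>,
  whose coefficient cancels the \<open>j\<close>-th moment.\<close>

lemma integral_power_mult_kernel:
  assumes u: "norm u = 1" and s: "0 \<le> s" "s < 1"
  shows "(\<integral>x. herm_inner x u ^ j * inverse ((1 - of_real s * cnj (herm_inner x u)) ^ CARD('n)) \<partial>\<sigma>) =
    of_real s ^ j"
proof -
  define b where "b k = (pochhammer (of_nat CARD('n)) k / fact k :: complex)" for k
  have hu: "cmod (herm_inner x u) \<le> 1" if "x \<in> sphere 0 1" for x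
    using norm_herm_inner_le[of x u] u that by simp
  \<comment> \<open>Convergence at the larger point \<open>t\<close> gives absolute convergence at
    \<open>s\<close>.\<close>
  obtain t where t: "s < t" "t < 1" using s dense by blast
  have "summable (\<lambda>k. b k * of_real t ^ k)"
    using negative_binomial_sums[of "of_real t" "CARD('n)"] s t
    by (auto simp: b_def sums_iff)
  from powser_insidea[OF this, of "of_real s"] s t
  have bs: "summable (\<lambda>k. cmod (b k * of_real s ^ k))" by simp
  have K: "(\<Sum>k. b k * of_real s ^ k * cnj (herm_inner x u) ^ k) =
      inverse ((1 - of_real s * cnj (herm_inner x u)) ^ CARD('n))" if "x \<in> sphere 0 1" for x
  proof -
    have "cmod (of_real s * cnj (herm_inner x u)) \<le> s"
      using s hu[OF that] by (simp add: norm_mult mult_left_le)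
    then have "cmod (of_real s * cnj (herm_inner x u)) < 1" using s by linarith
    from negative_binomial_sums[OF this, of "CARD('n)"] show ?thesis
      by (simp add: b_def sums_iff power_mult_distrib mult.assoc)
  qed
  have "(\<lambda>k. b k * of_real s ^ k * (\<integral>x. cnj (herm_inner x u) ^ k * herm_inner x u ^ j \<partial>\<sigma>)) sums
      (\<integral>x. (\<Sum>k. b k * of_real s ^ k * cnj (herm_inner x u) ^ k) * herm_inner x u ^ j \<partial>\<sigma>)"
    by (rule integral_power_series[OF bs]) (use hu in \<open>auto intro!: continuous_intros\<close>)
  also have "(\<integral>x. (\<Sum>k. b k * of_real s ^ k * cnj (herm_inner x u) ^ k) * herm_inner x u ^ j \<partial>\<sigma>) =
      (\<integral>x. herm_inner x u ^ j * inverse ((1 - of_real s * cnj (herm_inner x u)) ^ CARD('n)) \<partial>\<sigma>)"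
    by (intro Bochner_Integration.integral_cong) (auto simp: space_sigma K)
  finally have 1: "(\<lambda>k. b k * of_real s ^ k * (\<integral>x. cnj (herm_inner x u) ^ k * herm_inner x u ^ j \<partial>\<sigma>)) sums
      (\<integral>x. herm_inner x u ^ j * inverse ((1 - of_real s * cnj (herm_inner x u)) ^ CARD('n)) \<partial>\<sigma>)" .
  have "(\<integral>x. cnj (herm_inner x u) ^ k * herm_inner x u ^ j \<partial>\<sigma>) = 0" if "k \<noteq> j" for k
    using integral_monomial_orthogonal[OF u, of j k "\<lambda>x. 1"] that by (simp add: mult.commute)
  then have "(\<lambda>k. b k * of_real s ^ k * (\<integral>x. cnj (herm_inner x u) ^ k * herm_inner x u ^ j \<partial>\<sigma>)) sums
      (b j * of_real s ^ j * (\<integral>x. cnj (herm_inner x u) ^ j * herm_inner x u ^ j \<partial>\<sigma>))"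
    using sums_finite[of "{j}" "\<lambda>k. b k * of_real s ^ k *
        (\<integral>x. cnj (herm_inner x u) ^ k * herm_inner x u ^ j \<partial>\<sigma>)"] by simp
  also have "b j * of_real s ^ j * (\<integral>x. cnj (herm_inner x u) ^ j * herm_inner x u ^ j \<partial>\<sigma>) =
      of_real s ^ j * (moment u j * pochhammer (of_nat CARD('n)) j / fact j)"
    by (simp add: b_def moment_def mult_ac)
  also have "\<dots> = of_real s ^ j" by (simp add: moment_pochhammer[OF u])
  finally show ?thesis using 1 sums_unique2 by blast
qed

text \<open>On the line through \<open>w\<close> the kernel depends on \<open>x\<close> only through
  \<open>herm_inner x u\<close>, so slicing replaces \<open>f\<close> by a power series in one
  variable and the claim holds term by term. The radius \<open>R > 1\<close> gives absolutely
  summable coefficients.\<close>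

lemma cauchy_szego:
  assumes R: "1 < R" and f: "f holomorphic_vec_on ball 0 R" and w: "norm w < 1"
  shows "(\<integral>x. f x * inverse ((1 - herm_inner w x) ^ CARD('n)) \<partial>\<sigma>) = f w"
proof -
  define s where "s = norm w"
  \<comment> \<open>For \<open>w = 0\<close> any unit vector is admissible, because then
    \<open>s = 0\<close>.\<close>
  define u where "u = (if w = 0 then axis undefined 1 else (1 / norm w) *\<^sub>R w)"
  have u: "norm u = 1" by (simp add: u_def)
  have wu: "w = of_real s *s u" by (simp add: u_def s_def flip: scaleR_eq_smult)
  have s: "0 \<le> s" "s < 1" using w by (auto simp: s_def)
  have hu: "cmod (herm_inner x u) \<le> 1" if "x \<in> sphere 0 1" for x
    using norm_herm_inner_le[of x u] u that by simp
  define k where "k y = inverse ((1 - of_real s * cnj y) ^ CARD('n))" for y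
  have k: "continuous_on (cball 0 1) k"
  proof -
    have "1 - of_real s * cnj y \<noteq> 0" if "y \<in> cball 0 1" for y
    proof
      assume "1 - of_real s * cnj y = 0"
      then have "cmod (of_real s * cnj y) = 1" by (metis eq_iff_diff_eq_0 norm_one)
      moreover have "s * cmod y \<le> s" using mult_left_le[of "cmod y" s] s that by simp
      ultimately show False using s by (simp add: norm_mult)
    qed
    then show ?thesis unfolding k_def by (intro continuous_intros) auto
  qed
  have kc: "continuous_on (sphere 0 1) (\<lambda>x. k (herm_inner x u))"
    by (rule continuous_on_compose2[OF k]) (use hu in \<open>auto intro!: continuous_intros\<close>)
  define F where "F c = f (c *s u)" for c
  have F: "F holomorphic_on ball 0 R"
    using holomorphic_on_slice[OF f, of "ball 0 R" 0 u]
    by (simp add: F_def[abs_def] norm_smult_vec u)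
  define a where "a j = (deriv ^^ j) F 0 / fact j" for j
  have Fa: "(\<lambda>j. a j * c ^ j) sums F c" if "cmod c < R" for c
    using holomorphic_power_series[OF F, of c] that by (simp add: a_def)
  obtain t where t: "1 < t" "t < R" using R dense by blast
  have "summable (\<lambda>j. a j * of_real t ^ j)" using Fa[of "of_real t"] t by (simp add: sums_iff)
  from powser_insidea[OF this, of 1] t have a: "summable (\<lambda>j. cmod (a j))" by simp
  have "(\<lambda>j. a j * (\<integral>x. herm_inner x u ^ j * k (herm_inner x u) \<partial>\<sigma>)) sums
      (\<integral>x. (\<Sum>j. a j * herm_inner x u ^ j) * k (herm_inner x u) \<partial>\<sigma>)"
    by (rule integral_power_series[OF a]) (use hu kc in \<open>auto intro!: continuous_intros\<close>)
  then have 1: "(\<lambda>j. a j * of_real s ^ j) sums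
      (\<integral>x. (\<Sum>j. a j * herm_inner x u ^ j) * k (herm_inner x u) \<partial>\<sigma>)"
    using integral_power_mult_kernel[OF u s] by (simp add: k_def)
  have "(\<integral>x. f x * inverse ((1 - herm_inner w x) ^ CARD('n)) \<partial>\<sigma>) =
      (\<integral>x. f x * k (herm_inner x u) \<partial>\<sigma>)"
    by (simp add: k_def wu herm_inner_smult_left cnj_herm_inner)
  also have "\<dots> = (\<integral>x. f (herm_inner x u *s u) * k (herm_inner x u) \<partial>\<sigma>)"
    by (rule integral_slice[OF u R f k])
  also have "\<dots> = (\<integral>x. (\<Sum>j. a j * herm_inner x u ^ j) * k (herm_inner x u) \<partial>\<sigma>)"
  proof (rule Bochner_Integration.integral_cong[OF refl])
    fix x assume "x \<in> space \<sigma>"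
    then have "cmod (herm_inner x u) < R" using hu R by (force simp: space_sigma)
    from Fa[OF this]
    show "f (herm_inner x u *s u) * k (herm_inner x u) =
        (\<Sum>j. a j * herm_inner x u ^ j) * k (herm_inner x u)"
      by (simp add: sums_iff F_def)
  qed
  also have "\<dots> = F (of_real s)"
    using 1 Fa[of "of_real s"] s R by (simp add: sums_iff)
  finally show ?thesis by (simp add: F_def wu)
qed

lemma poisson_szego:
  assumes R: "1 < R" and f: "f holomorphic_vec_on ball 0 R" and a: "norm a < 1"
  shows "(\<integral>x. f x * of_real (poisson_kernel a x) \<partial>\<sigma>) = f a"
proof -
  define A where "A = 1 - (norm a)\<^sup>2"
  have A: "A > 0" using a by (simp add: A_def power_less_one_iff)
  \<comment> \<open>The additional kernel factor is singular where
    \<open>herm_inner x a = 1\<close>. Keeping \<open>R' * norm a\<close> at most 1 excludes such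
    points from the open ball while still reaching beyond the sphere.\<close>
  obtain R' where R': "1 < R'" "R' \<le> R" "R' * norm a \<le> 1"
  proof (cases "a = 0")
    case False
    show ?thesis
      using False a R by (intro that[of "min R (1 / norm a)"]) (auto simp: min_def field_simps)
  qed (use R that in auto)
  define h where "h x = inverse ((1 - herm_inner x a) ^ CARD('n))" for x
  have nz: "1 - herm_inner x a \<noteq> 0" if "norm x < R'" for x
  proof -
    have "cmod (herm_inner x a) < 1"
    proof (cases "a = 0")
      case False
      then have "norm x * norm a < R' * norm a" using that by simp
      then show ?thesis using norm_herm_inner_le[of x a] R'(3) by linarith
    qed (simp add: herm_inner_def)
    then show ?thesis by auto
  qed
  have "(\<lambda>x. inverse ((1 - herm_inner x a) ^ CARD('n))) holomorphic_vec_on ball 0 R'"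
    by (rule holomorphic_vec_on_compose_field[OF holomorphic_vec_on_affine_herm_inner])
      (use nz in \<open>auto intro!: field_differentiable_inverse derivative_intros\<close>)
  then have "(\<lambda>x. f x * h x) holomorphic_vec_on ball 0 R'"
    unfolding h_def
    by (intro holomorphic_vec_on_mult holomorphic_vec_on_subset[OF f]) (use R' in auto)
  from cauchy_szego[OF R'(1) this a]
  have *: "(\<integral>x. f x * h x * inverse ((1 - herm_inner a x) ^ CARD('n)) \<partial>\<sigma>) = f a * h a" .
  have ha: "h a = inverse (of_real A ^ CARD('n))"
    by (simp add: h_def A_def herm_inner_self)
  have eq: "f x * of_real ((A / (cmod (1 - herm_inner x a))\<^sup>2) ^ CARD('n)) =
      of_real A ^ CARD('n) * (f x * h x * inverse ((1 - herm_inner a x) ^ CARD('n)))" for x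
  proof -
    have "complex_of_real ((cmod (1 - herm_inner x a))\<^sup>2) = (1 - herm_inner x a) * (1 - herm_inner a x)"
      unfolding complex_norm_square by (simp add: cnj_herm_inner)
    then have "of_real ((A / (cmod (1 - herm_inner x a))\<^sup>2) ^ CARD('n)) =
        (of_real A * (inverse (1 - herm_inner x a) * inverse (1 - herm_inner a x))) ^ CARD('n)"
      unfolding of_real_power of_real_divide by (simp add: divide_inverse)
    then show ?thesis
      unfolding h_def power_inverse[symmetric] power_mult_distrib by (simp only: mult_ac)
  qed
  show ?thesis
    unfolding poisson_kernel_def A_def[symmetric] eq using A by (simp add: * ha)
qed

end

section \<open>Quantitative strict convexity of the power of the modulus\<close>

text \<open>Strict Bernoulli inequality. For positive \<open>x\<close>, the bound exp y \<ge> 1 + y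
  gives \<open>x powr p \<ge> x + (p - 1) * (x * ln x)\<close>, and strictness comes from
  \<open>x - 1 < x * ln x\<close>.\<close>

lemma powr_gt_tangent:
  fixes x p :: real
  assumes "1 < p" "0 \<le> x" "x \<noteq> 1"
  shows "1 + p * (x - 1) < x powr p"
proof (cases "x = 0")
  case False
  then have x: "x > 0" using assms by simp
  have "ln (1 / x) < 1 / x - 1"
  proof -
    have "ln (1 / x) \<le> 1 / x - 1" using x by (intro ln_le_minus_one) simp
    moreover have "ln (1 / x) \<noteq> 1 / x - 1"
      using ln_eq_minus_one[of "1 / x"] x assms(3) by auto
    ultimately show ?thesis by simp
  qed
  then have "- ln x < 1 / x - 1" using x by (simp add: ln_div)
  from mult_strict_left_mono[OF this x]
  have 1: "x - 1 < x * ln x" using x by (simp add: algebra_simps)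
  have "x powr p = x * x powr (p - 1)" using x by (simp add: powr_diff)
  also have "\<dots> \<ge> x * (1 + (p - 1) * ln x)"
    using x exp_ge_add_one_self[of "(p - 1) * ln x"] by (simp add: powr_def)
  moreover have "(p - 1) * (x - 1) < (p - 1) * (x * ln x)" using 1 assms(1) by simp
  ultimately show ?thesis by (simp add: algebra_simps)
qed (use assms in simp)

lemma powr_gt_tangent_at:
  fixes y t p :: real
  assumes p: "1 < p" and "0 \<le> y" "0 \<le> t" "t \<noteq> y"
  shows "y powr p + p * y powr (p - 1) * (t - y) < t powr p"
proof (cases "y = 0")
  case False
  then have y: "y > 0" using assms by simp
  have "1 + p * (t / y - 1) < (t / y) powr p"
    using assms y by (intro powr_gt_tangent) (auto simp: field_simps)
  then have "y powr p * (1 + p * (t / y - 1)) < y powr p * (t / y) powr p"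
    using y by (intro mult_strict_left_mono) auto
  also have "y powr p * (t / y) powr p = t powr p"
    using y assms by (simp add: powr_divide)
  also have "y powr p * (1 + p * (t / y - 1)) = y powr p + p * y powr (p - 1) * (t - y)"
    using y by (simp add: powr_diff field_simps)
  finally show ?thesis .
qed (use assms in simp)

text \<open>The height of \<open>cmod w powr p\<close> above its real tangent plane at
  \<open>c\<close>. The linear term is written as the real part of a complex affine function of
  \<open>w\<close>, so that it stays holomorphic under composition and the Poisson formula evaluates
  its mean. At \<open>c = 0\<close> it vanishes.\<close>

definition powr_excess :: "real \<Rightarrow> complex \<Rightarrow> complex \<Rightarrow> real" where
  "powr_excess p c w = cmod w powr p - cmod c powr p -
     Re (of_real (p * cmod c powr (p - 2)) * cnj c * (w - c))"

text \<open>If the moduli differ, strictness is that of the real power function. If they agree, it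
  comes from the phase: \<open>Re (cnj c * w)\<close> is then strictly below the product of the
  moduli.\<close>

lemma powr_excess_pos:
  assumes p: "1 < p" and "w \<noteq> c"
  shows "0 < powr_excess p c w"
proof -
  define r where "r = p * cmod c powr (p - 2)"
  have Re: "Re (of_real r * cnj c * (w - c)) = r * (Re (cnj c * w) - (cmod c)\<^sup>2)"
    unfolding cmod_power2 by (simp add: algebra_simps power2_eq_square)
  have r0: "r \<ge> 0" using p by (simp add: r_def)
  have le: "Re (cnj c * w) \<le> cmod c * cmod w"
    using complex_Re_le_cmod[of "cnj c * w"] by (simp add: norm_mult)
  have rc: "r * cmod c = p * cmod c powr (p - 1)"
  proof (cases "c = 0")
    case False
    then show ?thesis by (simp add: r_def powr_diff field_simps power2_eq_square)
  qed simp
  have ub: "r * (Re (cnj c * w) - (cmod c)\<^sup>2) \<le> p * cmod c powr (p - 1) * (cmod w - cmod c)"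
    using mult_left_mono[OF le r0] unfolding rc[symmetric]
    by (simp add: algebra_simps power2_eq_square)
  show ?thesis
  proof (cases "cmod w = cmod c")
    case False
    then have "cmod c powr p + p * cmod c powr (p - 1) * (cmod w - cmod c) < cmod w powr p"
      using p by (intro powr_gt_tangent_at) auto
    then show ?thesis using ub Re by (simp add: powr_excess_def r_def)
  next
    case eq: True
    have "c \<noteq> 0" using eq assms(2) by auto
    then have "r > 0" using p by (simp add: r_def)
    have "(cmod (w - c))\<^sup>2 = (cmod w)\<^sup>2 + (cmod c)\<^sup>2 - 2 * Re (cnj c * w)"
      unfolding cmod_power2 by (simp add: algebra_simps power2_eq_square)
    moreover have "(cmod (w - c))\<^sup>2 > 0" using assms(2) by simp
    ultimately have "Re (cnj c * w) - (cmod c)\<^sup>2 < 0" using eq by simp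
    then have "r * (Re (cnj c * w) - (cmod c)\<^sup>2) < 0"
      using \<open>r > 0\<close> by (simp add: mult_pos_neg)
    then show ?thesis using Re eq by (simp add: powr_excess_def r_def)
  qed
qed

lemma powr_excess_self [simp]: "powr_excess p c c = 0"
  by (simp add: powr_excess_def)

lemma powr_excess_nonneg: "1 < p \<Longrightarrow> 0 \<le> powr_excess p c w"
  using powr_excess_pos[of p w c] by (cases "w = c") auto

lemma convex_powr_norm:
  fixes x y p s :: real
  assumes p: "1 < p" and "0 \<le> x" "0 \<le> y" "0 \<le> s" "s \<le> 1"
  shows "((1 - s) * x + s * y) powr p \<le> (1 - s) * x powr p + s * y powr p"
proof -
  define m where "m = (1 - s) * x + s * y"
  have m: "0 \<le> m" using assms by (simp add: m_def)
  have tangent: "m powr p + p * m powr (p - 1) * (t - m) \<le> t powr p" if "0 \<le> t" for t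
    using powr_gt_tangent_at[OF p m that] by (cases "t = m") auto
  have "(1 - s) * (m powr p + p * m powr (p - 1) * (x - m)) +
      s * (m powr p + p * m powr (p - 1) * (y - m)) \<le> (1 - s) * x powr p + s * y powr p"
    using assms by (intro add_mono mult_left_mono tangent) auto
  also have "(1 - s) * (m powr p + p * m powr (p - 1) * (x - m)) +
      s * (m powr p + p * m powr (p - 1) * (y - m)) =
      m powr p + p * m powr (p - 1) * ((1 - s) * x + s * y - m)"
    by (simp add: algebra_simps)
  finally show ?thesis by (simp add: m_def)
qed

text \<open>The excess is convex in \<open>w\<close> and zero at \<open>c\<close>, so on a segment
  from \<open>c\<close> it stays below the chord.\<close>

lemma powr_excess_ray:
  assumes p: "1 < p" and s: "0 \<le> s" "s \<le> 1"
  shows "powr_excess p c (c + of_real s * (w - c)) \<le> s * powr_excess p c w"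
proof -
  define b where "b = complex_of_real (p * cmod c powr (p - 2)) * cnj c"
  have "cmod (c + of_real s * (w - c)) = cmod (of_real (1 - s) * c + of_real s * w)"
    by (simp add: algebra_simps)
  also have "\<dots> \<le> (1 - s) * cmod c + s * cmod w"
    using norm_triangle_ineq[of "of_real (1 - s) * c" "of_real s * w"] s
    unfolding norm_mult norm_of_real by simp
  finally have "cmod (c + of_real s * (w - c)) powr p \<le> ((1 - s) * cmod c + s * cmod w) powr p"
    using p by (intro powr_mono2) auto
  also have "\<dots> \<le> (1 - s) * cmod c powr p + s * cmod w powr p"
    using p s by (intro convex_powr_norm) auto
  moreover have "Re (b * (c + of_real s * (w - c) - c)) = s * Re (b * (w - c))"
    by (simp add: algebra_simps)
  ultimately show ?thesis
    unfolding powr_excess_def b_def[symmetric] by (simp add: algebra_simps)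
qed

lemma continuous_on_powr_excess:
  assumes "1 < p" "continuous_on S f"
  shows "continuous_on S (\<lambda>x. powr_excess p c (f x))"
  unfolding powr_excess_def using assms
  by (intro continuous_intros continuous_on_powr') auto

text \<open>By convexity the ratio of the excess to \<open>cmod (w - c)\<close> grows along rays from \<open>c\<close>, so its
  minimum over the circle of radius \<open>\<epsilon>\<close>, positive by strict convexity, bounds it outside.\<close>

lemma norm_diff_le_powr_excess:
  assumes p: "1 < p" and e: "0 < \<epsilon>"
  obtains C where "0 \<le> C" "\<And>w. cmod (w - c) \<le> \<epsilon> + C * powr_excess p c w"
proof -
  have "continuous_on (sphere c \<epsilon>) (powr_excess p c)"
    using continuous_on_powr_excess[OF p continuous_on_id] by simp
  moreover have "sphere c \<epsilon> \<noteq> {}" using e by simp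
  ultimately obtain v where v: "v \<in> sphere c \<epsilon>"
    "\<And>y. y \<in> sphere c \<epsilon> \<Longrightarrow> powr_excess p c v \<le> powr_excess p c y"
    using continuous_attains_inf[OF compact_sphere] by blast
  define \<delta> where "\<delta> = powr_excess p c v"
  have "v \<noteq> c" using v(1) e by auto
  then have d: "\<delta> > 0" unfolding \<delta>_def by (rule powr_excess_pos[OF p])
  show ?thesis
  proof (rule that[of "\<epsilon> / \<delta>"])
    show "0 \<le> \<epsilon> / \<delta>" using d e by simp
    fix w
    show "cmod (w - c) \<le> \<epsilon> + \<epsilon> / \<delta> * powr_excess p c w"
    proof (cases "cmod (w - c) \<le> \<epsilon>")
      case True
      then show ?thesis using powr_excess_nonneg[OF p, of c w] d e by (simp add: add_increasing2)
    next
      case False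
      \<comment> \<open>The factor that brings \<open>w\<close> back to the circle of radius
        \<open>\<epsilon>\<close>, where the excess is at least \<open>\<delta>\<close>.\<close>
      define s where "s = \<epsilon> / cmod (w - c)"
      have "cmod (w - c) > 0" using False e by linarith
      then have s: "0 \<le> s" "s \<le> 1" using False e by (auto simp: s_def)
      then have "c + of_real s * (w - c) \<in> sphere c \<epsilon>"
        using e \<open>cmod (w - c) > 0\<close> by (simp add: dist_norm norm_mult s_def norm_divide)
      then have "\<delta> \<le> s * powr_excess p c w"
        using v(2) powr_excess_ray[OF p s, of c w] unfolding \<delta>_def by (meson order_trans)
      then have "cmod (w - c) \<le> \<epsilon> / \<delta> * powr_excess p c w"
        using d \<open>cmod (w - c) > 0\<close> by (simp add: s_def field_simps)
      then show ?thesis using e by simp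
    qed
  qed
qed

section \<open>The extremal function and its domain of holomorphy\<close>

definition ball_extremal :: "real \<Rightarrow> complex ^ 'n \<Rightarrow> complex ^ 'n \<Rightarrow> complex" where
  "ball_extremal p a z =
     (of_real (1 - (norm a)\<^sup>2) / (1 - herm_inner z a)) powr of_real (2 * real CARD('n) / p)"

lemma Re_one_minus_herm_inner_pos:
  assumes "norm z * norm a < 1"
  shows "0 < Re (1 - herm_inner z a)"
  using complex_Re_le_cmod[of "herm_inner z a"] norm_herm_inner_le[of z a] assms by simp

lemma one_minus_norm_sq_pos: "norm a < 1 \<Longrightarrow> 0 < 1 - (norm a)\<^sup>2"
  by (simp add: power_less_one_iff abs_square_less_1)

lemma poisson_kernel_pos:
  assumes "norm a < 1" "norm z \<le> 1"
  shows "0 < poisson_kernel a z"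
proof -
  have "norm z * norm a < 1"
    using assms mult_right_mono[of "norm z" 1 "norm a"] by simp
  from Re_one_minus_herm_inner_pos[OF this] have "1 - herm_inner z a \<noteq> 0" by auto
  then show ?thesis
    using one_minus_norm_sq_pos[OF assms(1)] by (simp add: poisson_kernel_def)
qed

lemma continuous_on_poisson_kernel:
  assumes "norm a < 1"
  shows "continuous_on (cball 0 1) (poisson_kernel a)"
proof -
  have "1 - herm_inner z a \<noteq> 0" if "z \<in> cball 0 1" for z
  proof -
    have "norm z * norm a < 1"
      using assms that mult_right_mono[of "norm z" 1 "norm a"] by simp
    from Re_one_minus_herm_inner_pos[OF this] show ?thesis by auto
  qed
  then show ?thesis
    unfolding poisson_kernel_def by (intro continuous_intros) auto
qed

lemma ball_extremal_nonzero:
  assumes "norm a < 1" "norm z * norm a < 1"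
  shows "ball_extremal p a z \<noteq> 0"
proof -
  define A where "A = 1 - (norm a)\<^sup>2"
  have "A > 0" using one_minus_norm_sq_pos[OF assms(1)] by (simp add: A_def)
  then show ?thesis
    using Re_one_minus_herm_inner_pos[OF assms(2)]
    unfolding ball_extremal_def A_def[symmetric] by auto
qed

lemma ball_extremal_self:
  assumes "norm a < 1"
  shows "ball_extremal p a a = 1"
proof -
  have "1 - herm_inner a a = of_real (1 - (norm a)\<^sup>2)" by (simp add: herm_inner_self)
  then show ?thesis
    using one_minus_norm_sq_pos[OF assms] unfolding ball_extremal_def
    by (simp del: of_real_diff)
qed

text \<open>On this set the base of the power has positive real part and avoids the branch cut. For
  \<open>norm a < 1\<close> the set contains a neighbourhood of the closed ball.\<close>

lemma holomorphic_vec_on_ball_extremal: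
  fixes a :: "complex ^ 'n"
  assumes a: "norm a < 1"
  shows "ball_extremal p a holomorphic_vec_on {z. norm z * norm a < 1}"
    and "(\<lambda>z. inverse (ball_extremal p a z)) holomorphic_vec_on {z. norm z * norm a < 1}"
proof -
  define A where "A = 1 - (norm a)\<^sup>2"
  define q where "q = 2 * real CARD('n) / p"
  have A: "A > 0" using one_minus_norm_sq_pos[OF a] by (simp add: A_def)
  have "of_real A / w \<notin> \<real>\<^sub>\<le>\<^sub>0" if "0 < Re w" for w
  proof -
    have "0 < Re (of_real A / w)" using that A by (simp add: Re_complex_div_gt_0)
    then show ?thesis by (auto simp: complex_nonpos_Reals_iff)
  qed
  then have "(\<lambda>w. (of_real A / w) powr of_real q) holomorphic_on {w. 0 < Re w}"
    by (intro holomorphic_intros) auto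
  then have *: "(\<lambda>w. (of_real A / w) powr of_real q) field_differentiable at w" if "0 < Re w" for w
    using that open_halfspace_Re_gt[of 0] holomorphic_on_imp_differentiable_at by blast
  have "(\<lambda>z. (of_real A / (1 - herm_inner z a)) powr of_real q)
      holomorphic_vec_on {z. norm z * norm a < 1}"
    by (rule holomorphic_vec_on_compose_field[OF holomorphic_vec_on_affine_herm_inner])
      (auto intro!: * Re_one_minus_herm_inner_pos simp del: minus_complex.sel)
  then show 1: "ball_extremal p a holomorphic_vec_on {z. norm z * norm a < 1}"
    unfolding ball_extremal_def[abs_def] A_def q_def .
  show "(\<lambda>z. inverse (ball_extremal p a z)) holomorphic_vec_on {z. norm z * norm a < 1}"
    by (rule holomorphic_vec_on_compose_field[OF 1])
      (use ball_extremal_nonzero[OF a] in \<open>auto intro!: field_differentiable_inverse derivative_intros\<close>)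
qed

lemma norm_ball_extremal_powr:
  fixes a z :: "complex ^ 'n"
  assumes a: "norm a < 1" and z: "norm z * norm a < 1" and p: "p \<noteq> 0"
  shows "cmod (ball_extremal p a z) powr p = (1 - (norm a)\<^sup>2) ^ CARD('n) * poisson_kernel a z"
proof -
  define A where "A = 1 - (norm a)\<^sup>2"
  define d where "d = cmod (1 - herm_inner z a)"
  have A: "A > 0" using one_minus_norm_sq_pos[OF a] by (simp add: A_def)
  have d: "d > 0" using Re_one_minus_herm_inner_pos[OF z] by (auto simp: d_def)
  have "cmod (ball_extremal p a z) = (A / d) powr (2 * real CARD('n) / p)"
    unfolding ball_extremal_def A_def[symmetric]
    using A by (simp add: norm_powr_real_powr' norm_divide d_def)
  then have "cmod (ball_extremal p a z) powr p = (A / d) powr real (2 * CARD('n))"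
    using p by (simp add: powr_powr)
  also have "\<dots> = (A / d) ^ (2 * CARD('n))"
    using A d by (subst powr_realpow) auto
  also have "\<dots> = A ^ CARD('n) * (A / d\<^sup>2) ^ CARD('n)"
    by (simp add: power_mult power_divide power2_eq_square power_mult_distrib)
  finally show ?thesis by (simp add: poisson_kernel_def A_def d_def)
qed

section \<open>Poisson means and the identity for the Jensen defect\<close>

context sphere_measure
begin

lemma integral_poisson_kernel:
  assumes "norm a < 1"
  shows "(\<integral>x. poisson_kernel a x \<partial>\<sigma>) = 1"
proof -
  have "(\<integral>x. complex_of_real (poisson_kernel a x) \<partial>\<sigma>) = 1"
    using poisson_szego[OF _ holomorphic_vec_on_const assms, of 2 1] by simp
  then show ?thesis unfolding integral_complex_of_real by simp
qed

lemma integrable_poisson_mult: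
  fixes g :: "complex ^ 'n \<Rightarrow> 'b :: {real_normed_algebra_1, banach, second_countable_topology}"
  assumes "norm a < 1" "continuous_on (sphere 0 1) g"
  shows "integrable \<sigma> (\<lambda>x. g x * of_real (poisson_kernel a x))"
  using continuous_on_subset[OF continuous_on_poisson_kernel[OF assms(1)], of "sphere 0 1"]
  by (intro integrable_sigma continuous_intros assms) auto

text \<open>The dilation moves from \<open>x\<close> to \<open>a\<close>, since both give the same
  Hermitian product. Hence \<open>poisson_kernel a (r *\<^sub>R x)\<close> is a constant multiple of
  the kernel of \<open>r *\<^sub>R a\<close>, whose mean is 1.\<close>

lemma ball_extremal_mean:
  assumes a: "norm a < 1" and r: "0 < r" "r < 1" and p: "p \<noteq> 0"
  shows "(\<integral>x. cmod (ball_extremal p a (r *\<^sub>R x)) powr p \<partial>\<sigma>) =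
    ((1 - (norm a)\<^sup>2)\<^sup>2 / (1 - r\<^sup>2 * (norm a)\<^sup>2)) ^ CARD('n)"
proof -
  define A where "A = 1 - (norm a)\<^sup>2"
  define B where "B = 1 - r\<^sup>2 * (norm a)\<^sup>2"
  have ra: "norm (r *\<^sub>R a) < 1"
    using a r mult_right_mono[of r 1 "norm a"] by simp
  have B: "B > 0" using one_minus_norm_sq_pos[OF ra] r by (simp add: B_def power_mult_distrib)
  have eq: "cmod (ball_extremal p a (r *\<^sub>R x)) powr p =
      (A\<^sup>2 / B) ^ CARD('n) * poisson_kernel (r *\<^sub>R a) x" if "x \<in> space \<sigma>" for x
  proof -
    have "norm (r *\<^sub>R x) * norm a < 1" using that r ra by (simp add: space_sigma)
    then have "cmod (ball_extremal p a (r *\<^sub>R x)) powr p =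
        A ^ CARD('n) * poisson_kernel a (r *\<^sub>R x)"
      using norm_ball_extremal_powr[OF a _ p] by (simp add: A_def)
    also have "poisson_kernel a (r *\<^sub>R x) = (A / B) ^ CARD('n) * poisson_kernel (r *\<^sub>R a) x"
      using r B
      by (simp add: poisson_kernel_def herm_inner_scaleR_left herm_inner_scaleR_right
          power_mult_distrib[symmetric] A_def[symmetric])
        (simp add: power_mult_distrib B_def[symmetric])
    finally show ?thesis
      by (simp add: power2_eq_square power_divide power_mult_distrib)
  qed
  have "(\<integral>x. cmod (ball_extremal p a (r *\<^sub>R x)) powr p \<partial>\<sigma>) =
      (\<integral>x. (A\<^sup>2 / B) ^ CARD('n) * poisson_kernel (r *\<^sub>R a) x \<partial>\<sigma>)"
    by (intro Bochner_Integration.integral_cong eq) auto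
  then show ?thesis by (simp add: integral_poisson_kernel[OF ra] A_def B_def)
qed

lemma quotient_holomorphic:
  fixes a :: "complex ^ 'n"
  assumes a: "norm a < 1" and r: "0 < r" "r < 1" and g: "g holomorphic_vec_on ball 0 1"
  obtains R where "1 < R" "(\<lambda>x. g (r *\<^sub>R x) * inverse (ball_extremal p a x)) holomorphic_vec_on ball 0 R"
proof -
  \<comment> \<open>The dilated \<open>g\<close> lives on the ball of radius \<open>1 / r\<close>,
    the inverse of the extremal function on norm x * norm a < 1; the ball of radius
    \<open>1 / m\<close> lies in both and contains the closed unit ball.\<close>
  define m where "m = max r (norm a)"
  have m: "0 < m" "m < 1" "r \<le> m" "norm a \<le> m" using a r by (auto simp: m_def)
  have lt: "norm x * c < 1" if "x \<in> ball 0 (1 / m)" "c \<le> m" for c and x :: "complex ^ 'n"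
  proof -
    have "norm x * c \<le> norm x * m" using that by (intro mult_left_mono) auto
    also have "\<dots> < 1" using that m by (simp add: field_simps)
    finally show ?thesis .
  qed
  show ?thesis
  proof (rule that[of "1 / m"])
    show "1 < 1 / m" using m by simp
    have "(\<lambda>x. g (r *\<^sub>R x)) holomorphic_vec_on ball 0 (1 / m)"
      by (rule holomorphic_vec_on_scaleR[OF g]) (use lt[OF _ m(3)] r in \<open>auto simp: mult.commute\<close>)
    moreover have "(\<lambda>x. inverse (ball_extremal p a x)) holomorphic_vec_on ball 0 (1 / m)"
      by (rule holomorphic_vec_on_subset[OF holomorphic_vec_on_ball_extremal(2)[OF a]])
        (use lt[OF _ m(4)] in auto)
    ultimately show "(\<lambda>x. g (r *\<^sub>R x) * inverse (ball_extremal p a x)) holomorphic_vec_on ball 0 (1 / m)"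
      by (rule holomorphic_vec_on_mult)
  qed
qed

text \<open>Jensen's inequality with its exact remainder. The kernel cancels against the power of
  the extremal function in the first term, and the Poisson formula evaluates the linear term at
  \<open>a\<close>. The base point \<open>c\<close> stays free, so that it can be held at
  \<open>g a\<close> while \<open>r\<close> varies.\<close>

lemma integral_powr_excess:
  assumes a: "norm a < 1" and r: "0 < r" "r < 1" and g: "g holomorphic_vec_on ball 0 1"
    and p: "1 < p"
  defines "G \<equiv> \<lambda>x. g (r *\<^sub>R x) * inverse (ball_extremal p a x)"
  shows "(\<integral>x. powr_excess p c (G x) * poisson_kernel a x \<partial>\<sigma>) =
    (\<integral>x. cmod (g (r *\<^sub>R x)) powr p \<partial>\<sigma>) / (1 - (norm a)\<^sup>2) ^ CARD('n) - cmod c powr p -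
      Re (of_real (p * cmod c powr (p - 2)) * cnj c * (g (r *\<^sub>R a) - c))"
proof -
  define A where "A = 1 - (norm a)\<^sup>2"
  define b where "b = complex_of_real (p * cmod c powr (p - 2)) * cnj c"
  have A: "A > 0" using one_minus_norm_sq_pos[OF a] by (simp add: A_def)
  obtain R where R: "1 < R" "G holomorphic_vec_on ball 0 R"
    using quotient_holomorphic[OF a r g, of p] unfolding G_def by blast
  have Gc: "continuous_on (sphere 0 1) G"
    by (rule continuous_on_subset[OF holomorphic_vec_on_imp_continuous_on[OF R(2)]])
      (use R(1) in auto)
  have gc: "continuous_on (sphere 0 1) (\<lambda>x. g (r *\<^sub>R x))"
    using r by (intro continuous_on_compose2[OF holomorphic_vec_on_imp_continuous_on[OF g]]
        continuous_intros) auto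
  have "(\<lambda>z. b * (G z + - c)) holomorphic_vec_on ball 0 R"
    by (rule holomorphic_vec_on_compose_field[OF R(2)]) (auto intro!: derivative_intros)
  from poisson_szego[OF R(1) this a]
  have lin: "(\<integral>x. b * (G x - c) * of_real (poisson_kernel a x) \<partial>\<sigma>) = b * (G a - c)" by simp
  have linc: "integrable \<sigma> (\<lambda>x. b * (G x - c) * of_real (poisson_kernel a x))"
    by (intro integrable_poisson_mult a continuous_intros Gc)
  have Re_lin: "(\<integral>x. Re (b * (G x - c)) * poisson_kernel a x \<partial>\<sigma>) = Re (b * (G a - c))"
    and Re_int: "integrable \<sigma> (\<lambda>x. Re (b * (G x - c)) * poisson_kernel a x)"
    using arg_cong[OF lin, of Re] integrable_Re[OF linc]
    by (simp_all add: integral_Re[OF linc, symmetric])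
  have Pint: "integrable \<sigma> (\<lambda>x. cmod c powr p * poisson_kernel a x)"
    using integrable_poisson_mult[OF a, of "\<lambda>x. cmod c powr p"] by simp
  have gint: "integrable \<sigma> (\<lambda>x. cmod (g (r *\<^sub>R x)) powr p / A ^ CARD('n))"
    using p A by (intro integrable_sigma continuous_intros continuous_on_powr' gc) auto
  have eq: "powr_excess p c (G x) * poisson_kernel a x =
      cmod (g (r *\<^sub>R x)) powr p / A ^ CARD('n) - cmod c powr p * poisson_kernel a x -
      Re (b * (G x - c)) * poisson_kernel a x" if "x \<in> space \<sigma>" for x
  proof -
    have x: "norm x * norm a < 1" using that a by (simp add: space_sigma)
    have "poisson_kernel a x > 0" using that a by (intro poisson_kernel_pos) (simp_all add: space_sigma)
    moreover have "cmod (G x) powr p = cmod (g (r *\<^sub>R x)) powr p / cmod (ball_extremal p a x) powr p"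
      by (simp add: G_def norm_divide powr_divide flip: divide_inverse)
    ultimately have "cmod (G x) powr p * poisson_kernel a x = cmod (g (r *\<^sub>R x)) powr p / A ^ CARD('n)"
      using norm_ball_extremal_powr[OF a x, of p] p A by (simp add: A_def)
    then show ?thesis by (simp add: powr_excess_def b_def algebra_simps)
  qed
  have "(\<integral>x. powr_excess p c (G x) * poisson_kernel a x \<partial>\<sigma>) =
      (\<integral>x. cmod (g (r *\<^sub>R x)) powr p / A ^ CARD('n) - cmod c powr p * poisson_kernel a x -
      Re (b * (G x - c)) * poisson_kernel a x \<partial>\<sigma>)"
    by (intro Bochner_Integration.integral_cong eq) auto
  also have "\<dots> = (\<integral>x. cmod (g (r *\<^sub>R x)) powr p \<partial>\<sigma>) / A ^ CARD('n) -
      cmod c powr p - Re (b * (G a - c))"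
    unfolding Bochner_Integration.integral_diff[OF Bochner_Integration.integrable_diff[OF gint Pint] Re_int]
      Bochner_Integration.integral_diff[OF gint Pint] Re_lin
    by (simp add: integral_poisson_kernel[OF a])
  also have "G a = g (r *\<^sub>R a)" by (simp add: G_def ball_extremal_self[OF a])
  finally show ?thesis by (simp add: A_def b_def)
qed

end

section \<open>The sharp bound and uniqueness\<close>

lemma eventually_at_left_1_unit: "\<forall>\<^sub>F r in at_left (1::real). 0 < r \<and> r < 1"
  using eventually_at_left[of 0 "1::real"] by (auto intro: exI[of _ 0])

context sphere_measure
begin

lemma hardy_norm_mean_le:
  assumes "hardy_norm \<sigma> p g \<le> ennreal N" "0 \<le> N" "0 < p" "0 < r" "r < 1"
  shows "(\<integral>x. cmod (g (r *\<^sub>R x)) powr p \<partial>\<sigma>) \<le> N powr p"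
proof -
  define I where "I = (\<integral>x. cmod (g (r *\<^sub>R x)) powr p \<partial>\<sigma>)"
  have I: "0 \<le> I" unfolding I_def by (rule integral_nonneg_AE) simp
  have "ennreal (I powr (1 / p)) \<le> hardy_norm \<sigma> p g"
    unfolding hardy_norm_def I_def by (rule SUP_upper) (use assms in auto)
  then have "ennreal (I powr (1 / p)) \<le> ennreal N" using assms(1) by (rule order_trans)
  then have "I powr (1 / p) \<le> N" using assms(2) by (simp add: ennreal_le_iff)
  then have "(I powr (1 / p)) powr p \<le> N powr p" using assms(3) by (intro powr_mono2) auto
  then show ?thesis using I assms(3) by (simp add: powr_powr I_def)
qed

lemma tendsto_radial:
  assumes "g holomorphic_vec_on ball 0 1" "norm z < 1"
  shows "((\<lambda>r. g (r *\<^sub>R z)) \<longlongrightarrow> g z) (at_left 1)"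
proof -
  have "isCont g z"
    using holomorphic_vec_on_imp_continuous_on[OF assms(1)] assms(2)
    by (simp add: continuous_on_eq_continuous_at)
  moreover have "((\<lambda>r::real. r *\<^sub>R z) \<longlongrightarrow> 1 *\<^sub>R z) (at_left 1)" by (intro tendsto_intros)
  ultimately show ?thesis using isCont_tendsto_compose by force
qed

text \<open>The defect with base point \<open>g a\<close> is nonnegative at every radius; in the
  limit \<open>r \<rightarrow> 1\<close> its linear term disappears and the inequality between
  \<open>p\<close>-th powers remains.\<close>

lemma hardy_norm_ge:
  assumes a: "norm a < 1" and p: "1 < p" and g: "g holomorphic_vec_on ball 0 1"
    and N: "hardy_norm \<sigma> p g \<le> ennreal N" "0 \<le> N"
  shows "cmod (g a) * (1 - (norm a)\<^sup>2) powr (real CARD('n) / p) \<le> N"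
proof -
  define A where "A = 1 - (norm a)\<^sup>2"
  have A: "A > 0" using one_minus_norm_sq_pos[OF a] by (simp add: A_def)
  define b where "b = complex_of_real (p * cmod (g a) powr (p - 2)) * cnj (g a)"
  have "0 \<le> N powr p / A ^ CARD('n) - cmod (g a) powr p - Re (b * (g (r *\<^sub>R a) - g a))"
    if r: "0 < r" "r < 1" for r
  proof -
    have "0 \<le> (\<integral>x. powr_excess p (g a) (g (r *\<^sub>R x) * inverse (ball_extremal p a x)) *
        poisson_kernel a x \<partial>\<sigma>)"
      using poisson_kernel_pos[OF a] powr_excess_nonneg[OF p]
      by (intro integral_nonneg_AE AE_I2 mult_nonneg_nonneg) (auto simp: space_sigma less_imp_le)
    also have "\<dots> = (\<integral>x. cmod (g (r *\<^sub>R x)) powr p \<partial>\<sigma>) / A ^ CARD('n) - cmod (g a) powr p -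
        Re (b * (g (r *\<^sub>R a) - g a))"
      unfolding integral_powr_excess[OF a r g p] A_def b_def ..
    also have "\<dots> \<le> N powr p / A ^ CARD('n) - cmod (g a) powr p - Re (b * (g (r *\<^sub>R a) - g a))"
      using A hardy_norm_mean_le[OF N _ r] p by (simp add: divide_right_mono)
    finally show ?thesis .
  qed
  then have "\<forall>\<^sub>F r in at_left 1.
      0 \<le> N powr p / A ^ CARD('n) - cmod (g a) powr p - Re (b * (g (r *\<^sub>R a) - g a))"
    using eventually_at_left_1_unit by (auto elim: eventually_mono)
  moreover have "((\<lambda>r. N powr p / A ^ CARD('n) - cmod (g a) powr p - Re (b * (g (r *\<^sub>R a) - g a)))
      \<longlongrightarrow> N powr p / A ^ CARD('n) - cmod (g a) powr p - Re (b * (g a - g a))) (at_left 1)"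
    by (intro tendsto_intros tendsto_radial[OF g a])
  ultimately have "0 \<le> N powr p / A ^ CARD('n) - cmod (g a) powr p - Re (b * (g a - g a))"
    by (intro tendsto_lowerbound) auto
  then have "cmod (g a) powr p * A ^ CARD('n) \<le> N powr p"
    using A by (simp add: field_simps)
  then have "(cmod (g a) powr p * A powr real CARD('n)) powr (1 / p) \<le> (N powr p) powr (1 / p)"
    using A p by (intro powr_mono2) (auto simp: powr_realpow)
  then show ?thesis using A N(2) p by (simp add: powr_mult powr_powr A_def[symmetric])
qed

lemma hardy_norm_ball_extremal_le:
  assumes a: "norm a < 1" and p: "1 < p"
  shows "hardy_norm \<sigma> p (\<lambda>z. w * ball_extremal p a z) \<le>
    ennreal (cmod w * (1 - (norm a)\<^sup>2) powr (real CARD('n) / p))"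
  unfolding hardy_norm_def
proof (rule SUP_least)
  fix r :: real assume "r \<in> {0<..<1}"
  then have r: "0 < r" "r < 1" by auto
  define A where "A = 1 - (norm a)\<^sup>2"
  define B where "B = 1 - r\<^sup>2 * (norm a)\<^sup>2"
  have A: "A > 0" using one_minus_norm_sq_pos[OF a] by (simp add: A_def)
  have AB: "A \<le> B" using r by (simp add: A_def B_def mult_left_le_one_le power_le_one)
  \<comment> \<open>This single comparison bounds the mean at every radius by the value claimed for
    the supremum.\<close>
  then have "A * A / B \<le> A" using A by (simp add: pos_divide_le_eq)
  have "(\<integral>x. cmod (w * ball_extremal p a (r *\<^sub>R x)) powr p \<partial>\<sigma>) = cmod w powr p * (A\<^sup>2 / B) ^ CARD('n)"
    using ball_extremal_mean[OF a r, of p] p by (simp add: norm_mult powr_mult A_def B_def)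
  also have "\<dots> \<le> cmod w powr p * A ^ CARD('n)"
    using \<open>A * A / B \<le> A\<close> A AB by (intro mult_left_mono power_mono) (auto simp: power2_eq_square)
  finally have "(\<integral>x. cmod (w * ball_extremal p a (r *\<^sub>R x)) powr p \<partial>\<sigma>) powr (1 / p) \<le>
      (cmod w powr p * A powr real CARD('n)) powr (1 / p)"
    using A p by (intro powr_mono2 integral_nonneg_AE) (auto simp: powr_realpow)
  also have "\<dots> = cmod w * A powr (real CARD('n) / p)"
    using A p by (simp add: powr_mult powr_powr)
  finally show "ennreal ((\<integral>x. cmod (w * ball_extremal p a (r *\<^sub>R x)) powr p \<partial>\<sigma>) powr (1 / p)) \<le>
      ennreal (cmod w * (1 - (norm a)\<^sup>2) powr (real CARD('n) / p))"
    by (simp add: A_def ennreal_leI)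
qed

text \<open>As \<open>r\<close> tends to 1, the Poisson mean of the excess of \<open>g(rx) / H(x)\<close> over \<open>g a\<close> tends to 0, hence
  so does the mean distance of this quotient from \<open>g a\<close>, and the Cauchy formula carries this inside.\<close>

lemma extremal_unique:
  assumes a: "norm a < 1" and p: "1 < p" and g: "g holomorphic_vec_on ball 0 1"
    and le: "hardy_norm \<sigma> p g \<le> ennreal (cmod (g a) * (1 - (norm a)\<^sup>2) powr (real CARD('n) / p))"
    and z: "norm z < 1"
  shows "g z = g a * ball_extremal p a z"
proof -
  define A where "A = 1 - (norm a)\<^sup>2"
  have A: "A > 0" using one_minus_norm_sq_pos[OF a] by (simp add: A_def)
  define N where "N = cmod (g a) * A powr (real CARD('n) / p)"
  have N: "hardy_norm \<sigma> p g \<le> ennreal N" "0 \<le> N" using le by (simp_all add: N_def A_def)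
  have Np: "N powr p = cmod (g a) powr p * A ^ CARD('n)"
    using A p by (simp add: N_def powr_mult powr_powr powr_realpow)
  define b where "b = complex_of_real (p * cmod (g a) powr (p - 2)) * cnj (g a)"
  \<comment> \<open>The value \<open>r = 1\<close> is allowed: \<open>G 1 z\<close> is the quotient
    of \<open>g\<close> by the extremal function at an interior point, the limit to be
    identified.\<close>
  define G where "G r x = g (r *\<^sub>R x) * inverse (ball_extremal p a x)" for r x
  define S where "S x = inverse ((1 - herm_inner z x) ^ CARD('n))" for x
  have nz: "1 - herm_inner z x \<noteq> 0" if "x \<in> sphere 0 1" for x
    using Re_one_minus_herm_inner_pos[of z x] z that by auto
  have Sc: "continuous_on (sphere 0 1) S"
    unfolding S_def using nz by (intro continuous_intros) auto
  have Pc: "continuous_on (sphere 0 1) (poisson_kernel a)"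
    by (rule continuous_on_subset[OF continuous_on_poisson_kernel[OF a]]) auto
  have Pp: "0 < poisson_kernel a x" if "x \<in> sphere 0 1" for x
    using poisson_kernel_pos[OF a] that by simp
  have "continuous_on (sphere 0 1) (\<lambda>x. S x / of_real (poisson_kernel a x))"
    using Pp by (intro continuous_intros Sc Pc) force
  then have "compact ((\<lambda>x. S x / of_real (poisson_kernel a x)) ` sphere 0 1)"
    by (intro compact_continuous_image) auto
  then have "bounded ((\<lambda>x. S x / of_real (poisson_kernel a x)) ` sphere 0 1)"
    by (rule compact_imp_bounded)
  \<comment> \<open>The Poisson kernel is continuous and positive on the compact sphere, so it
    dominates the Cauchy kernel of \<open>z\<close> up to a constant. This turns integrals against
    \<open>S\<close> into Poisson means.\<close>
  then obtain M where M: "\<And>x. x \<in> sphere 0 1 \<Longrightarrow> cmod (S x / of_real (poisson_kernel a x)) \<le> M"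
    unfolding bounded_iff by blast
  have SM: "cmod (S x) \<le> M * poisson_kernel a x" if "x \<in> sphere 0 1" for x
    using M[OF that] Pp[OF that] by (simp add: norm_divide field_simps)
  have M0: "0 \<le> M"
  proof -
    have "axis undefined 1 \<in> sphere (0 :: complex ^ 'n) 1" by simp
    from M[OF this] show ?thesis by (meson norm_ge_zero order_trans)
  qed
  have bound: "cmod (G r z - g a) \<le> M * (\<epsilon> + C * - Re (b * (g (r *\<^sub>R a) - g a)))"
    if r: "0 < r" "r < 1" and C: "0 \<le> C" "\<And>w. cmod (w - g a) \<le> \<epsilon> + C * powr_excess p (g a) w"
    for r \<epsilon> C
  proof -
    obtain R where R: "1 < R" "G r holomorphic_vec_on ball 0 R"
      using quotient_holomorphic[OF a r g, of p] unfolding G_def by blast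
    have Gc: "continuous_on (sphere 0 1) (G r)"
      by (rule continuous_on_subset[OF holomorphic_vec_on_imp_continuous_on[OF R(2)]])
        (use R(1) in auto)
    have Ec: "continuous_on (sphere 0 1) (\<lambda>x. powr_excess p (g a) (G r x))"
      by (rule continuous_on_powr_excess[OF p Gc])
    have "(\<lambda>x. G r x + - g a) holomorphic_vec_on ball 0 R"
      by (rule holomorphic_vec_on_compose_field[OF R(2)]) (auto intro!: derivative_intros)
    from cauchy_szego[OF R(1) this z]
    have "G r z - g a = (\<integral>x. (G r x - g a) * S x \<partial>\<sigma>)" by (simp add: S_def)
    then have "cmod (G r z - g a) \<le> (\<integral>x. cmod ((G r x - g a) * S x) \<partial>\<sigma>)"
      by simp
    also have "\<dots> \<le> (\<integral>x. M * (\<epsilon> * poisson_kernel a x +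
        C * (powr_excess p (g a) (G r x) * poisson_kernel a x)) \<partial>\<sigma>)"
    proof (rule integral_mono)
      fix x assume "x \<in> space \<sigma>"
      then have x: "x \<in> sphere 0 1" by (simp add: space_sigma)
      have "cmod (G r x - g a) * cmod (S x) \<le>
          (\<epsilon> + C * powr_excess p (g a) (G r x)) * (M * poisson_kernel a x)"
        using C(2)[of "G r x"] SM[OF x] order_trans[OF norm_ge_zero C(2), of "G r x"]
        by (intro mult_mono) auto
      then show "cmod ((G r x - g a) * S x) \<le> M * (\<epsilon> * poisson_kernel a x +
          C * (powr_excess p (g a) (G r x) * poisson_kernel a x))"
        unfolding norm_mult by (simp add: algebra_simps)
    qed (intro integrable_sigma continuous_intros Gc Sc Pc Ec)+
    also have "\<dots> = M * (\<epsilon> + C * (\<integral>x. powr_excess p (g a) (G r x) * poisson_kernel a x \<partial>\<sigma>))"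
    proof -
      have "integrable \<sigma> (poisson_kernel a)"
        "integrable \<sigma> (\<lambda>x. powr_excess p (g a) (G r x) * poisson_kernel a x)"
        by (intro integrable_sigma continuous_intros Pc Ec)+
      then show ?thesis by (simp add: integral_poisson_kernel[OF a])
    qed
    also have "\<dots> \<le> M * (\<epsilon> + C * - Re (b * (g (r *\<^sub>R a) - g a)))"
    proof -
      \<comment> \<open>Here the minimality of the norm enters: the normalised mean is at most
        \<open>cmod (g a) powr p\<close>, which cancels the constant term of the defect.\<close>
      have "(\<integral>x. cmod (g (r *\<^sub>R x)) powr p \<partial>\<sigma>) / A ^ CARD('n) \<le> N powr p / A ^ CARD('n)"
        using A p by (intro divide_right_mono hardy_norm_mean_le[OF N _ r]) auto
      also have "\<dots> = cmod (g a) powr p" using A by (simp add: Np)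
      finally have "(\<integral>x. powr_excess p (g a) (G r x) * poisson_kernel a x \<partial>\<sigma>) \<le>
          - Re (b * (g (r *\<^sub>R a) - g a))"
        unfolding G_def integral_powr_excess[OF a r g p] A_def[symmetric] b_def[symmetric] by simp
      then show ?thesis using M0 C(1) by (intro mult_left_mono add_left_mono) auto
    qed
    finally show ?thesis .
  qed
  \<comment> \<open>The order of the limits matters: \<open>\<epsilon>\<close> fixes
    \<open>C\<close>, then \<open>r \<rightarrow> 1\<close> removes the term with \<open>C\<close>,
    and only afterwards \<open>\<epsilon>\<close> tends to 0.\<close>
  have small: "cmod (G 1 z - g a) \<le> M * \<epsilon>" if e: "0 < \<epsilon>" for \<epsilon>
  proof -
    obtain C where C: "0 \<le> C" "\<And>w. cmod (w - g a) \<le> \<epsilon> + C * powr_excess p (g a) w"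
      using norm_diff_le_powr_excess[OF p e] by blast
    have "\<forall>\<^sub>F r in at_left 1. cmod (G r z - g a) \<le> M * (\<epsilon> + C * - Re (b * (g (r *\<^sub>R a) - g a)))"
      using eventually_at_left_1_unit by eventually_elim (use bound C in blast)
    moreover have "((\<lambda>r. cmod (G r z - g a)) \<longlongrightarrow> cmod (G 1 z - g a)) (at_left 1)"
      unfolding G_def using tendsto_radial[OF g z] by (auto intro!: tendsto_intros)
    moreover have "((\<lambda>r. M * (\<epsilon> + C * - Re (b * (g (r *\<^sub>R a) - g a)))) \<longlongrightarrow>
        M * (\<epsilon> + C * - Re (b * (g a - g a)))) (at_left 1)"
      by (intro tendsto_intros tendsto_radial[OF g a])
    ultimately have "cmod (G 1 z - g a) \<le> M * (\<epsilon> + C * - Re (b * (g a - g a)))"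
      by (intro tendsto_le[of "at_left (1::real)"]) auto
    then show ?thesis by simp
  qed
  have "cmod (G 1 z - g a) \<le> 0"
  proof (rule field_le_epsilon)
    fix e :: real assume e: "0 < e"
    have "cmod (G 1 z - g a) \<le> M * (e / (M + 1))" using M0 e by (intro small) simp
    also have "\<dots> \<le> 0 + e" using M0 e by (simp add: field_simps)
    finally show "cmod (G 1 z - g a) \<le> 0 + e" .
  qed
  then have "G 1 z = g a" by simp
  moreover have "norm z * norm a < 1"
    using z a mult_strict_mono'[of "norm z" 1 "norm a" 1] by simp
  then have "ball_extremal p a z \<noteq> 0" by (rule ball_extremal_nonzero[OF a])
  ultimately show ?thesis by (simp add: G_def field_simps)
qed

end

theorem theorem4p1:
  fixes \<sigma> :: "(complex ^ 'n) measure" and p :: real and z0 :: "complex ^ 'n" and w0 :: complex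
  assumes "rotation_invariant_prob \<sigma>"
    and "1 < p"
    and "z0 \<in> ball 0 1"
  shows "\<exists>fmin.
     minimal_interpolant \<sigma> p z0 w0 fmin \<and>
     (\<forall>g. minimal_interpolant \<sigma> p z0 w0 g \<longrightarrow> (\<forall>z\<in>ball 0 1. g z = fmin z)) \<and>
     (\<forall>z\<in>ball 0 1.
        fmin z = w0 * (complex_of_real (1 - (norm z0)\<^sup>2) / (1 - herm_inner z z0))
                        powr complex_of_real (2 * real CARD('n) / p) \<and>
        fmin z = w0 * (complex_of_real (1 - (\<Sum>j\<in>UNIV. (cmod (z0 $ j))\<^sup>2)) /
                         (1 - (\<Sum>j\<in>UNIV. z $ j * cnj (z0 $ j))))
                        powr complex_of_real (2 * real CARD('n) / p)) \<and>
     hardy_norm \<sigma> p fmin = ennreal (cmod w0 * (1 - (norm z0)\<^sup>2) powr (real CARD('n) / p))"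
proof -
  interpret sphere_measure \<sigma> by (rule sphere_measure.intro[OF assms(1)])
  have p: "1 < p" and a: "norm z0 < 1" using assms by auto
  define f where "f z = w0 * ball_extremal p z0 z" for z
  define m where "m = cmod w0 * (1 - (norm z0)\<^sup>2) powr (real CARD('n) / p)"
  have m0: "0 \<le> m" by (simp add: m_def)
  have lower: "ennreal m \<le> hardy_norm \<sigma> p g" if "g \<in> hardy_space \<sigma> p" "g z0 = w0" for g
  proof -
    have g: "g holomorphic_vec_on ball 0 1" and fin: "hardy_norm \<sigma> p g < \<infinity>"
      using that(1) by (auto simp: hardy_space_def)
    obtain N where N: "0 \<le> N" "hardy_norm \<sigma> p g = ennreal N"
      using fin by (cases "hardy_norm \<sigma> p g") auto
    from hardy_norm_ge[OF a p g _ N(1)] N(2) that(2) have "m \<le> N" by (simp add: m_def)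
    then show ?thesis using N by (simp add: ennreal_leI)
  qed
  have upper: "hardy_norm \<sigma> p f \<le> ennreal m"
    unfolding f_def m_def by (rule hardy_norm_ball_extremal_le[OF a p])
  have "norm z * norm z0 < 1" if "norm z < 1" for z :: "complex ^ 'n"
    using that a mult_strict_mono'[of "norm z" 1 "norm z0" 1] by simp
  then have "f holomorphic_vec_on ball 0 1"
    unfolding f_def
    by (intro holomorphic_vec_on_mult holomorphic_vec_on_const
        holomorphic_vec_on_subset[OF holomorphic_vec_on_ball_extremal(1)[OF a]]) auto
  then have fH: "f \<in> hardy_space \<sigma> p"
    using upper by (simp add: hardy_space_def le_less_trans[OF _ ennreal_less_top])
  have fz0: "f z0 = w0" by (simp add: f_def ball_extremal_self[OF a])
  \<comment> \<open>The function \<open>f\<close> is itself a competitor, so the general lower bound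
    yields its exact norm without computing the supremum.\<close>
  have norm_f: "hardy_norm \<sigma> p f = ennreal m"
    using upper lower[OF fH fz0] by (rule antisym)
  have 1: "minimal_interpolant \<sigma> p z0 w0 f"
    using fH fz0 lower by (simp add: minimal_interpolant_def norm_f)
  have 2: "g z = f z" if "minimal_interpolant \<sigma> p z0 w0 g" "z \<in> ball 0 1" for g z
  proof -
    have g: "g holomorphic_vec_on ball 0 1" "g z0 = w0" "hardy_norm \<sigma> p g \<le> hardy_norm \<sigma> p f"
      using that(1) fH fz0 by (auto simp: minimal_interpolant_def hardy_space_def)
    from extremal_unique[OF a p g(1)] g(2,3) that(2) show ?thesis
      by (simp add: norm_f m_def f_def)
  qed
  have 3: "(\<Sum>j\<in>UNIV. (cmod (z0 $ j))\<^sup>2) = (norm z0)\<^sup>2"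
    by (simp add: norm_vec_def L2_set_def sum_nonneg)
  have 4: "f z = w0 * (complex_of_real (1 - (norm z0)\<^sup>2) / (1 - herm_inner z z0))
      powr complex_of_real (2 * real CARD('n) / p)" for z
    by (simp only: f_def ball_extremal_def)
  show ?thesis
    unfolding 3 herm_inner_def[symmetric] m_def[symmetric]
    by (intro exI[of _ f] conjI allI impI ballI 1 2 4 norm_f)
qed

end
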